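(* Let $A$ be a unital $C^*$-algebra, let $\mathcal{H}$ be a finitely or countably generated Hilbert $A$-module, let $\Psi=\{\psi_j\in\mathcal{H}: j\in J\}$, and let $C\in GL(\mathcal{H})$ be self-adjoint and diagonal on $\Psi$, i.e. there is a sequence $W=\{\omega_j\}_{j\in J}\subseteq Z(A)$ with $C\psi_j=\omega_j\psi_j$ for all $j\in J$. Assume that $\Psi$ is a $C$-controlled frame for $\mathcal{H}$. Then the sequence $W$ satisfying $C\psi_j=\omega_j\psi_j$ is semi-normalized and positive. Furthermore, $C=M_{W,\tilde\Psi,\Psi}$, that is, $Cf=\sum_{j\in J}\omega_j\langle f,\tilde\psi_j\rangle\psi_j$ for all $f\in\mathcal{H}$, where $\tilde\Psi=\{\tilde\psi_j\}_{j\in J}$ is the canonical dual frame of $\Psi$.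
   Context: Hilbert $A$-modules are left modules, with $A$-valued inner product $\langle\cdot,\cdot\rangle$ that is $A$-linear in the first variable, and norm $\|f\|=\|\langle f,f\rangle\|^{1/2}$. $J$ is a finite or countable index set. $Z(A)$ is the center of $A$. $GL(\mathcal{H})$ is the set of bounded linear operators on $\mathcal{H}$ with a bounded inverse. Given $C\in GL(\mathcal{H})$, a family $\{\psi_j\}_{j\in J}\subseteq\mathcal{H}$ is a $C$-controlled frame if there exist $m>0$ and $M<\infty$ such that $$m\langle f,f\rangle\le\sum_{j\in J}\langle f,\psi_j\rangle\langle C\psi_j,f\rangle\le M\langle f,f\rangle\quad\text{for all } f\in\mathcal{H},$$ where the sum converges in norm and the inequalities are in the order of $A$. In that case the operator $S_Cf=\sum_{j\in J}\langle f,\psi_j\rangle C\psi_j$ is well defined on $\mathcal{H}$, and $\Psi$ is a frame: there are $\alpha,\beta>0$ with $\alpha\langle f,f\rangle\le\sum_j\langle f,\psi_j\rangle\langle\psi_j,f\rangle\le\beta\langle f,f\rangle$ for all $f$. The frame operator is $Sf=\sum_{j\in J}\langle f,\psi_j\rangle\psi_j$ (it is invertible), and the canonical dual frame is $\tilde\psi_j=S^{-1}\psi_j$. A sequence $\{c_j\}_{j\in J}\subseteq Z(A)$ is semi-normalized if there are real bounds $b\ge a>0$ with $a\le|c_j|\le b$ for all $j$ (order of $A$; $a,b$ denote multiples of the unit; $|c|=(c^*c)^{1/2}$). It is positive if each $c_j\ge0$. For Bessel sequences $\{f_j\},\{g_j\}$ and a symbol $m=\{m_j\}\subseteq Z(A)$,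 the multiplier is $M_{m,\{f_j\},\{g_j\}}f=\sum_{j\in J}m_j\langle f,f_j\rangle g_j$.
   Formalization: W itself is shown semi-normalized and positive only if no nonzero central element annihilates any ψ_j (else W is not unique and the claim can fail, e.g. ψ_j=0); in general some semi-normalized positive W' with Cψ_j=ω'_jψ_j exists, equal to W at each j where ω_j is determined. *)

theory Defs
  imports "HOL-Analysis.Analysis"
begin

section \<open>Unital \<open>C\<^sup>*\<close>-algebras\<close>

text \<open>The superclasses give the real Banach algebra structure with a unit of norm 1; in particular the
  zero algebra is excluded. The complex scalar multiplication extends the real one.\<close>

class unital_cstar_algebra = real_normed_algebra_1 + banach +
  fixes scaleC :: "complex \<Rightarrow> 'a \<Rightarrow> 'a"
    and star :: "'a \<Rightarrow> 'a"
  assumes scaleC_add_right: "scaleC z (a + b) = scaleC z a + scaleC z b"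
    and scaleC_add_left: "scaleC (z + w) a = scaleC z a + scaleC w a"
    and scaleC_scaleC: "scaleC z (scaleC w a) = scaleC (z * w) a"
    and scaleC_of_real: "scaleC (complex_of_real r) a = scaleR r a"
    and scaleC_mult_left: "scaleC z a * b = scaleC z (a * b)"
    and scaleC_mult_right: "a * scaleC z b = scaleC z (a * b)"
    and norm_scaleC: "norm (scaleC z a) = cmod z * norm a"
    and star_add: "star (a + b) = star a + star b"
    and star_scaleC: "star (scaleC z a) = scaleC (cnj z) (star a)"
    and star_mult: "star (a * b) = star b * star a"
    and star_star: "star (star a) = a"
    and cstar_identity: "norm (star a * a) = (norm a)\<^sup>2"

definition spectrum :: "'a::unital_cstar_algebra \<Rightarrow> complex set" where
  "spectrum a = {z. \<nexists>b. (scaleC z 1 - a) * b = 1 \<and> b * (scaleC z 1 - a) = 1}"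

definition positive_elem :: "'a::unital_cstar_algebra \<Rightarrow> bool" where
  "positive_elem a \<longleftrightarrow> star a = a \<and> spectrum a \<subseteq> complex_of_real ` {0..}"

definition cstar_le :: "'a::unital_cstar_algebra \<Rightarrow> 'a \<Rightarrow> bool"  (infix "\<preceq>" 50) where
  "a \<preceq> b \<longleftrightarrow> positive_elem (b - a)"

text \<open>The modulus \<open>(c\<^sup>* c)\<close> to the power one half: the unique positive square root.\<close>

definition cstar_abs :: "'a::unital_cstar_algebra \<Rightarrow> 'a" where
  "cstar_abs c = (THE p. positive_elem p \<and> p * p = star c * c)"

definition algebra_center :: "'a::unital_cstar_algebra set" where
  "algebra_center = {c. \<forall>a. c * a = a * c}"

definition semi_normalized :: "'j set \<Rightarrow> ('j \<Rightarrow> 'a::unital_cstar_algebra) \<Rightarrow> bool" where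
  "semi_normalized J c \<longleftrightarrow>
     (\<forall>j\<in>J. c j \<in> algebra_center) \<and>
     (\<exists>a b::real. 0 < a \<and> a \<le> b \<and>
        (\<forall>j\<in>J. of_real a \<preceq> cstar_abs (c j) \<and> cstar_abs (c j) \<preceq> of_real b))"

definition positive_seq :: "'j set \<Rightarrow> ('j \<Rightarrow> 'a::unital_cstar_algebra) \<Rightarrow> bool" where
  "positive_seq J c \<longleftrightarrow> (\<forall>j\<in>J. positive_elem (c j))"

section \<open>Hilbert modules\<close>

text \<open>Left Hilbert modules; \<open>act\<close> is the module action and \<open>ip\<close> the algebra-valued inner product.
  The type class \<open>banach\<close> provides the underlying complete normed space, and the last two axioms say
  that its scalar multiplication is the one induced by the module action and that its norm is the
  one induced by the inner product. Complex scalars \<open>z\<close> act as \<open>act (scaleC z 1)\<close>.\<close>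

locale hilbert_module =
  fixes act :: "'a::unital_cstar_algebra \<Rightarrow> 'h::banach \<Rightarrow> 'h"
    and ip :: "'h \<Rightarrow> 'h \<Rightarrow> 'a"
  assumes act_add_right: "act a (f + g) = act a f + act a g"
    and act_add_left: "act (a + b) f = act a f + act b f"
    and act_act: "act a (act b f) = act (a * b) f"
    and act_one: "act 1 f = f"
    and ip_add_left: "ip (f + g) h = ip f h + ip g h"
    and ip_act_left: "ip (act a f) g = a * ip f g"
    and ip_star: "star (ip f g) = ip g f"
    and ip_positive: "positive_elem (ip f f)"
    and ip_definite: "ip f f = 0 \<Longrightarrow> f = 0"
    and act_of_real: "act (of_real r) f = scaleR r f"
    and norm_eq: "norm f = sqrt (norm (ip f f))"

definition finitely_generated :: "('a::unital_cstar_algebra \<Rightarrow> 'h::banach \<Rightarrow> 'h) \<Rightarrow> bool" where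
  "finitely_generated act \<longleftrightarrow> (\<exists>G. finite G \<and> (\<forall>f. \<exists>a. f = (\<Sum>g\<in>G. act (a g) g)))"

definition countably_generated :: "('a::unital_cstar_algebra \<Rightarrow> 'h::banach \<Rightarrow> 'h) \<Rightarrow> bool" where
  "countably_generated act \<longleftrightarrow>
     (\<exists>G. countable G \<and> closure {\<Sum>g\<in>F. act (a g) g |F a. finite F \<and> F \<subseteq> G} = UNIV)"

definition GL :: "('a::unital_cstar_algebra \<Rightarrow> 'h::banach \<Rightarrow> 'h) \<Rightarrow> ('h \<Rightarrow> 'h) set" where
  "GL act = {C. bounded_linear C \<and> (\<forall>z f. C (act (scaleC z 1) f) = act (scaleC z 1) (C f)) \<and>
                (\<exists>D. bounded_linear D \<and> C \<circ> D = id \<and> D \<circ> C = id)}"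

definition self_adjoint :: "('h::banach \<Rightarrow> 'h \<Rightarrow> 'a::unital_cstar_algebra) \<Rightarrow> ('h \<Rightarrow> 'h) \<Rightarrow> bool" where
  "self_adjoint ip C \<longleftrightarrow> (\<forall>f g. ip (C f) g = ip f (C g))"

definition diagonal_on ::
  "('a::unital_cstar_algebra \<Rightarrow> 'h::banach \<Rightarrow> 'h) \<Rightarrow> 'j set \<Rightarrow> ('j \<Rightarrow> 'h) \<Rightarrow> ('h \<Rightarrow> 'h) \<Rightarrow> ('j \<Rightarrow> 'a) \<Rightarrow> bool"
where
  "diagonal_on act J \<psi> C \<omega> \<longleftrightarrow> (\<forall>j\<in>J. \<omega> j \<in> algebra_center \<and> C (\<psi> j) = act (\<omega> j) (\<psi> j))"

text \<open>No nonzero central element annihilates \<open>f\<close>; equivalently, central coefficients of \<open>f\<close> are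
  uniquely determined. If the center consists of the scalars, this just says \<open>f \<noteq> 0\<close>.\<close>

definition centrally_faithful ::
  "('a::unital_cstar_algebra \<Rightarrow> 'h::banach \<Rightarrow> 'h) \<Rightarrow> 'h \<Rightarrow> bool" where
  "centrally_faithful act f \<longleftrightarrow> (\<forall>a\<in>algebra_center. act a f = 0 \<longrightarrow> a = 0)"

section \<open>Frames and multipliers\<close>

text \<open>As the index set carries no order, series are unordered sums in the norm topology.\<close>

definition controlled_frame ::
  "('h::banach \<Rightarrow> 'h \<Rightarrow> 'a::unital_cstar_algebra) \<Rightarrow> ('h \<Rightarrow> 'h) \<Rightarrow> 'j set \<Rightarrow> ('j \<Rightarrow> 'h) \<Rightarrow> bool" where
  "controlled_frame ip C J \<psi> \<longleftrightarrow>
     (\<exists>m M::real. 0 < m \<and> (\<forall>f.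
        (\<lambda>j. ip f (\<psi> j) * ip (C (\<psi> j)) f) summable_on J \<and>
        of_real m * ip f f \<preceq> (\<Sum>\<^sub>\<infinity>j\<in>J. ip f (\<psi> j) * ip (C (\<psi> j)) f) \<and>
        (\<Sum>\<^sub>\<infinity>j\<in>J. ip f (\<psi> j) * ip (C (\<psi> j)) f) \<preceq> of_real M * ip f f))"

definition frame_operator ::
  "('a::unital_cstar_algebra \<Rightarrow> 'h::banach \<Rightarrow> 'h) \<Rightarrow> ('h \<Rightarrow> 'h \<Rightarrow> 'a) \<Rightarrow> 'j set \<Rightarrow> ('j \<Rightarrow> 'h) \<Rightarrow> 'h \<Rightarrow> 'h"
where
  "frame_operator act ip J \<psi> f = (\<Sum>\<^sub>\<infinity>j\<in>J. act (ip f (\<psi> j)) (\<psi> j))"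

definition canonical_dual ::
  "('a::unital_cstar_algebra \<Rightarrow> 'h::banach \<Rightarrow> 'h) \<Rightarrow> ('h \<Rightarrow> 'h \<Rightarrow> 'a) \<Rightarrow> 'j set \<Rightarrow> ('j \<Rightarrow> 'h) \<Rightarrow> 'j \<Rightarrow> 'h"
where
  "canonical_dual act ip J \<psi> j = inv (frame_operator act ip J \<psi>) (\<psi> j)"

definition multiplier ::
  "('a::unital_cstar_algebra \<Rightarrow> 'h::banach \<Rightarrow> 'h) \<Rightarrow> ('h \<Rightarrow> 'h \<Rightarrow> 'a) \<Rightarrow> 'j set \<Rightarrow>
     ('j \<Rightarrow> 'a) \<Rightarrow> ('j \<Rightarrow> 'h) \<Rightarrow> ('j \<Rightarrow> 'h) \<Rightarrow> 'h \<Rightarrow> 'h"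
where
  "multiplier act ip J m F G f = (\<Sum>\<^sub>\<infinity>j\<in>J. act (m j * ip f (F j)) (G j))"

end

theory Submission
  imports Defs
begin

text \<open>Let \<open>p\<^sub>j = \<langle>\<psi>\<^sub>j, \<psi>\<^sub>j\<rangle>\<close>. Polarizing the controlled frame sum between \<open>f\<close> and \<open>C\<^sup>-\<^sup>1 f\<close> shows that \<open>\<Psi>\<close> is a
  Bessel sequence, so the frame operator \<open>S\<close> exists, commutes with \<open>C\<close>, and \<open>m \<le> C S \<le> M\<close>. A self-adjoint
  operator with such form bounds differs, after scaling, from the identity by a strict contraction, so
  \<open>C S\<close> and \<open>S\<close> are bijective, which gives \<open>C = M\<^bsub>W,\<Psi>~,\<Psi>\<^esub>\<close> termwise. For the coefficients, \<open>\<omega>\<^sub>j \<langle>S \<psi>\<^sub>j, \<psi>\<^sub>j\<rangle> \<ge> m p\<^sub>j\<close> forces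
  the negative part of \<open>\<omega>\<^sub>j\<close> to annihilate \<open>\<psi>\<^sub>j\<close>, and the bounds of \<open>C\<close> and \<open>C\<^sup>-\<^sup>1\<close> confine \<open>\<omega>\<^sub>j\<close>, as far as it
  acts on \<open>\<psi>\<^sub>j\<close>, to an interval \<open>[a, b]\<close> with \<open>a > 0\<close> independent of \<open>j\<close>.\<close>

section \<open>Spectra in unital \<open>C\<^sup>*\<close>-algebras\<close>

text \<open>A central coefficient is determined by \<open>\<psi> j\<close> only up to central
  elements that annihilate \<open>\<psi> j\<close>; for \<open>\<psi> j = 0\<close> every
  \<open>\<omega> j\<close> is admissible. So a given \<open>\<omega>\<close> cannot be bounded in
  general: the bounds are proved for a family \<open>\<omega>'\<close> with the same action on the
  frame, and they reach \<open>\<omega> j\<close> itself where \<open>\<psi> j\<close> is centrally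
  faithful. The estimates therefore replace a coefficient repeatedly by another central element that
  acts on \<open>\<psi> j\<close> in the same way. No functional calculus is used. Square roots that
  commute with whatever commutes with the given element, together with inverses, are the only
  functions of an element constructed here; this is why coefficients are reflected, which takes only
  an absolute value, instead of being cut off.\<close>

lemma scaleC_one [simp]: "scaleC 1 a = a"
  using scaleC_of_real[of 1 a] by simp

lemma scaleC_zero_left [simp]: "scaleC 0 a = 0"
  using scaleC_of_real[of 0 a] by simp

lemma scaleC_minus_left: "scaleC (- z) a = - scaleC z a"
  using scaleC_add_left[of z "- z" a] by (simp add: eq_neg_iff_add_eq_0 add.commute)

lemma scaleC_minus_right: "scaleC z (- a) = - scaleC z a"
proof -
  have "scaleC z a + scaleC z (- a) = scaleC z 0"
    using scaleC_add_right[of z a "- a"] by simp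
  also have "\<dots> = 0" using scaleC_add_right[of z 0 0] by simp
  finally show ?thesis by (rule minus_unique[symmetric])
qed

lemma scaleC_diff_left: "scaleC (z - w) a = scaleC z a - scaleC w a"
  using scaleC_add_left[of z "- w" a] by (simp add: scaleC_minus_left)

lemma scaleC_diff_right: "scaleC z (a - b) = scaleC z a - scaleC z b"
  using scaleC_add_right[of z a "- b"] by (simp add: scaleC_minus_right)

lemma of_real_eq_scaleC: "of_real r = scaleC (complex_of_real r) 1"
  by (simp only: of_real_def[where 'a='a] scaleC_of_real)

lemma of_real_mult_eq: "of_real r * (a::'a::real_algebra_1) = r *\<^sub>R a"
  by (simp add: of_real_def)

lemma mult_of_real_eq: "(a::'a::real_algebra_1) * of_real r = r *\<^sub>R a"
  by (simp add: of_real_def)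

lemma scaleC_power: "(scaleC z a) ^ n = scaleC (z ^ n) (a ^ n)"
  by (induction n) (simp_all add: scaleC_mult_left scaleC_mult_right scaleC_scaleC mult.commute)

lemma star_zero [simp]: "star 0 = 0"
  using star_add[of 0 0] by simp

lemma star_one [simp]: "star 1 = 1"
  using star_mult[of "star 1" 1] by (simp add: star_star)

lemma star_minus: "star (- a) = - star a"
  using star_add[of a "- a"] by (simp add: eq_neg_iff_add_eq_0 add.commute)

lemma star_diff: "star (a - b) = star a - star b"
  using star_add[of a "- b"] by (simp add: star_minus)

lemma star_scaleR: "star (r *\<^sub>R a) = r *\<^sub>R star a"
  using star_scaleC[of "complex_of_real r" a] by (simp add: scaleC_of_real)

lemma star_of_real [simp]: "star (of_real r) = of_real r"
  by (simp add: of_real_def star_scaleR)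

lemma star_power: "star (a ^ n) = star a ^ n"
  by (induction n) (simp_all add: star_mult power_commutes)

lemma norm_star [simp]: "norm (star a) = norm a"
proof -
  have le: "norm b \<le> norm (star b)" for b :: 'a
    using norm_mult_ineq[of "star b" b] cstar_identity[of b]
    by (cases "b = 0") (auto simp: power2_eq_square)
  show ?thesis using le[of a] le[of "star a"] by (simp add: star_star)
qed

lemma bounded_linear_star: "bounded_linear star"
  by (rule bounded_linear_intro[where K = 1]) (auto simp: star_add star_scaleR)

lemma norm_square_selfadjoint: "star a = a \<Longrightarrow> norm (a * a) = (norm a)\<^sup>2"
  using cstar_identity[of a] by simp

lemma square_eq_0_iff: "star a = a \<Longrightarrow> a * a = 0 \<longleftrightarrow> a = 0"
  using norm_square_selfadjoint[of a] by auto

text \<open>The C*-identity doubles the exponent, so it reaches the powers of two; these are the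
  exponents in the averaging argument for the spectral radius.\<close>

lemma norm_power_selfadjoint:
  assumes "star a = a"
  shows "norm (a ^ (2 ^ k)) = norm a ^ (2 ^ k)"
proof (induction k)
  case (Suc k)
  have "a ^ (2 ^ Suc k) = a ^ (2 ^ k) * a ^ (2 ^ k)"
    by (simp add: power_add[symmetric] mult_2)
  then have "norm (a ^ (2 ^ Suc k)) = (norm (a ^ (2 ^ k)))\<^sup>2"
    using norm_square_selfadjoint[of "a ^ (2 ^ k)"] assms by (simp add: star_power)
  then show ?case by (simp add: Suc power_mult[symmetric] mult.commute)
qed simp

section \<open>Invertible elements and the spectrum\<close>

definition unit_elem :: "'a::monoid_mult \<Rightarrow> bool" where
  "unit_elem a \<longleftrightarrow> (\<exists>b. a * b = 1 \<and> b * a = 1)"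

lemma spectrum_iff: "z \<in> spectrum a \<longleftrightarrow> \<not> unit_elem (scaleC z 1 - a)"
  by (simp add: spectrum_def unit_elem_def)

lemma unit_elem_left_right:
  fixes a :: "'a::monoid_mult"
  assumes "a * b = 1" "c * a = 1"
  shows "unit_elem a"
proof -
  have "c = c * (a * b)" using assms by simp
  also have "\<dots> = b" using assms(2) by (simp flip: mult.assoc)
  finally show ?thesis using assms unfolding unit_elem_def by auto
qed

lemma unit_elem_mult:
  fixes a b :: "'a::monoid_mult"
  assumes "unit_elem a" "unit_elem b" shows "unit_elem (a * b)"
proof -
  obtain a' b' where *: "a * a' = 1" "a' * a = 1" "b * b' = 1" "b' * b = 1"
    using assms unfolding unit_elem_def by blast
  have "(a * b) * (b' * a') = a * (b * b') * a'" "(b' * a') * (a * b) = b' * (a' * a) * b"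
    by (simp_all only: mult.assoc)
  then show ?thesis using * unfolding unit_elem_def by (metis mult.right_neutral)
qed

lemma unit_elem_uminus: "unit_elem (- a) \<longleftrightarrow> unit_elem (a::'a::ring_1)"
  unfolding unit_elem_def by (metis minus_mult_minus minus_minus)

lemma unit_elem_minus_commute: "unit_elem (a - b) \<longleftrightarrow> unit_elem (b - (a::'a::ring_1))"
  using unit_elem_uminus[of "a - b"] by simp

lemma unit_elem_scaleC:
  assumes "z \<noteq> 0" shows "unit_elem (scaleC z a) \<longleftrightarrow> unit_elem a"
proof -
  have *: "unit_elem (scaleC w b)" if "unit_elem b" "w \<noteq> 0" for w b
  proof -
    from that(1) obtain c where "b * c = 1" "c * b = 1" unfolding unit_elem_def by auto
    with that(2) have "scaleC w b * scaleC (inverse w) c = 1" "scaleC (inverse w) c * scaleC w b = 1"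
      by (simp_all add: scaleC_mult_left scaleC_mult_right scaleC_scaleC)
    then show ?thesis unfolding unit_elem_def by blast
  qed
  show ?thesis
    using *[of a z] *[of "scaleC z a" "inverse z"] assms by (auto simp: scaleC_scaleC)
qed

lemma unit_elem_one_minus:
  fixes x :: "'a::{real_normed_algebra_1,banach}"
  assumes "norm x < 1"
  shows "unit_elem (1 - x)"
proof -
  define y where "y = (\<Sum>n. x ^ n)"
  have s: "summable (\<lambda>n. x ^ n)" by (rule complete_algebra_summable_geometric[OF assms])
  have "y = 1 + (\<Sum>n. x ^ Suc n)"
    using suminf_split_head[OF s] by (simp add: y_def)
  moreover have "(\<Sum>n. x ^ Suc n) = x * y"
    using suminf_mult[OF s, of x] by (simp add: y_def)
  moreover have "(\<Sum>n. x ^ Suc n) = y * x"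
    using suminf_mult2[OF s, of x] by (simp add: y_def power_commutes)
  ultimately have "(1 - x) * y = 1" "y * (1 - x) = 1" by (simp_all add: algebra_simps)
  then show ?thesis unfolding unit_elem_def by blast
qed

lemma spectrum_norm_le:
  assumes "z \<in> spectrum a" shows "cmod z \<le> norm a"
proof (rule ccontr)
  assume "\<not> ?thesis"
  then have z: "cmod z > norm a" "z \<noteq> 0" by auto
  then have "norm (scaleC (inverse z) a) < 1"
    by (simp add: norm_scaleC norm_inverse norm_divide field_simps)
  then have "unit_elem (1 - scaleC (inverse z) a)" by (rule unit_elem_one_minus)
  then have "unit_elem (scaleC z (1 - scaleC (inverse z) a))"
    using z by (simp add: unit_elem_scaleC)
  then show False using assms z by (simp add: spectrum_iff scaleC_diff_right scaleC_scaleC)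
qed

lemma spectrum_translate: "z + w \<in> spectrum (a + scaleC w 1) \<longleftrightarrow> z \<in> spectrum a"
  by (simp add: spectrum_iff scaleC_add_left)

lemma spectrum_uminus: "- z \<in> spectrum (- a) \<longleftrightarrow> z \<in> spectrum a"
  using unit_elem_uminus[of "scaleC z 1 - a"] by (simp add: spectrum_iff scaleC_minus_left)

lemma spectrum_of_real_minus:
  "of_real t - z \<in> spectrum (of_real t - a) \<longleftrightarrow> z \<in> spectrum a"
  using spectrum_translate[of "- z" "of_real t" "- a"] spectrum_uminus[of z a]
  by (simp add: of_real_eq_scaleC)

lemma spectrum_minus_of_real:
  "z - of_real t \<in> spectrum (a - of_real t) \<longleftrightarrow> z \<in> spectrum a"
  using spectrum_translate[of "z - of_real t" "of_real t" "a - of_real t"]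
  by (simp add: of_real_eq_scaleC)

text \<open>Adding \<open>\<i> * t\<close> moves the spectrum by \<open>t\<close> along the
  imaginary axis, while by the C*-identity the bound on the squared norm grows only by
  \<open>t\<^sup>2\<close>. The squared imaginary part gains the extra term
  \<open>2 * Im z * t\<close>, which is unbounded in \<open>t\<close> unless
  \<open>Im z = 0\<close>.\<close>

lemma spectrum_selfadjoint_real:
  assumes a: "star a = a" and z: "z \<in> spectrum a"
  shows "Im z = 0"
proof (rule ccontr)
  assume i: "Im z \<noteq> 0"
  have *: "(Im z)\<^sup>2 + 2 * Im z * t \<le> (norm a)\<^sup>2" for t
  proof -
    define b where "b = a + scaleC (\<i> * of_real t) 1"
    have sb: "star b = a - scaleC (\<i> * of_real t) 1"
      using a by (simp add: b_def star_add star_scaleC scaleC_minus_left)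
    have "star b * b = a * a + of_real (t\<^sup>2)"
      by (simp add: sb) (simp add: b_def algebra_simps scaleC_mult_left scaleC_mult_right scaleC_scaleC
          scaleC_minus_left scaleC_diff_right of_real_eq_scaleC power2_eq_square)
    then have "(norm b)\<^sup>2 \<le> norm (a * a) + t\<^sup>2"
      using cstar_identity[of b] norm_triangle_ineq[of "a * a" "of_real (t\<^sup>2)"]
      by (simp del: of_real_power)
    also have "\<dots> = (norm a)\<^sup>2 + t\<^sup>2" using norm_square_selfadjoint[OF a] by simp
    finally have 1: "(norm b)\<^sup>2 \<le> (norm a)\<^sup>2 + t\<^sup>2" .
    have "z + \<i> * of_real t \<in> spectrum b" unfolding b_def using z by (simp add: spectrum_translate)
    then have "cmod (z + \<i> * of_real t) \<le> norm b" by (rule spectrum_norm_le)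
    then have "(Im z + t)\<^sup>2 \<le> (norm b)\<^sup>2"
      using abs_Im_le_cmod[of "z + \<i> * of_real t"] by (simp add: abs_le_square_iff[symmetric])
    with 1 show ?thesis by (simp add: power2_eq_square algebra_simps)
  qed
  show False
    using *[of "((norm a)\<^sup>2 + 1) / (2 * Im z)"] i zero_le_power2[of "Im z"] by simp
qed

text \<open>Resolvent identity: \<open>f w - f z = (w - z) * f w * a * f z\<close>. The variable is
  the reciprocal of the usual spectral parameter, so that infinity becomes \<open>z = 0\<close> and
  a compact disc suffices.\<close>

lemma continuous_on_resolvent:
  assumes f: "\<And>z. z \<in> K \<Longrightarrow> (1 - scaleC z a) * f z = 1 \<and> f z * (1 - scaleC z a) = 1"
  shows "continuous_on K f"
  unfolding continuous_on_iff
proof (intro ballI allI impI)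
  fix z :: complex and e :: real assume z: "z \<in> K" and e: "0 < e"
  define k where "k = norm (f z)"
  define l where "l = norm a"
  have kl: "k \<ge> 0" "l \<ge> 0" by (simp_all add: k_def l_def)
  \<comment> \<open>The first bound keeps \<open>norm (f w)\<close> at most \<open>2 * k\<close>,
    the second makes the resulting estimate \<open>r * (2 * l * k\<^sup>2)\<close> smaller than
    \<open>e\<close>.\<close>
  define d where "d = min (1 / (2 * (l * k + 1))) (e / (2 * l * k\<^sup>2 + 1))"
  have p: "0 < l * k + 1" "0 < 2 * l * k\<^sup>2 + 1"
    using kl by (simp_all add: add_nonneg_pos)
  then have d: "d > 0" using e by (simp add: d_def)
  have "dist (f w) (f z) < e" if w: "w \<in> K" "dist w z < d" for w
  proof -
    define r where "r = cmod (w - z)"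
    have r: "0 \<le> r" "r < 1 / (2 * (l * k + 1))" "r < e / (2 * l * k\<^sup>2 + 1)"
      using w(2) by (simp_all add: r_def d_def dist_norm)
    have "scaleC w a - scaleC z a = (1 - scaleC z a) - (1 - scaleC w a)" by simp
    then have "f w * (scaleC w a - scaleC z a) * f z
        = f w * ((1 - scaleC z a) * f z) - (f w * (1 - scaleC w a)) * f z"
      by (simp only: right_diff_distrib left_diff_distrib mult.assoc)
    then have "f w - f z = scaleC (w - z) (f w * a * f z)"
      using f[OF z] f[OF w(1)]
      by (simp add: scaleC_diff_left[symmetric] scaleC_mult_left scaleC_mult_right)
    then have "norm (f w - f z) = r * norm (f w * a * f z)"
      by (simp add: norm_scaleC r_def)
    also have "norm (f w * a * f z) \<le> norm (f w) * l * k"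
      unfolding k_def l_def by (meson norm_mult_ineq mult_right_mono norm_ge_zero order_trans)
    finally have 1: "norm (f w - f z) \<le> r * (norm (f w) * l * k)"
      using r by (simp add: mult_left_mono)
    have "r * (l * k) \<le> r * (l * k + 1)" using r by (simp add: mult_left_mono)
    also have "\<dots> \<le> 1 / 2" using r(2) p(1) by (simp add: field_simps)
    finally have "r * (l * k) \<le> 1 / 2" .
    then have "r * (l * k) * norm (f w) \<le> 1 / 2 * norm (f w)"
      by (rule mult_right_mono) simp
    then have "norm (f w) \<le> 2 * k"
      using 1 norm_triangle_ineq2[of "f w" "f z"] by (simp add: k_def mult_ac)
    then have "norm (f w) * (l * k) \<le> 2 * k * (l * k)"
      by (rule mult_right_mono) (use kl in simp)
    then have "r * (norm (f w) * (l * k)) \<le> r * (2 * l * k\<^sup>2)"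
      using r(1) by (intro mult_left_mono) (simp_all add: power2_eq_square mult_ac)
    also have "\<dots> \<le> r * (2 * l * k\<^sup>2 + 1)" using r(1) by (intro mult_left_mono) simp_all
    also have "\<dots> < e" using r(3) p(2) by (simp add: field_simps)
    finally show ?thesis using 1 by (simp add: dist_norm mult_ac)
  qed
  with d show "\<exists>d>0. \<forall>w\<in>K. dist w z < d \<longrightarrow> dist (f w) (f z) < e" by blast
qed

text \<open>A spectral radius argument that avoids complex integration: with \<open>f\<close> the resolvent,
  \<open>A k z\<close> is the mean of \<open>f\<close> over the points \<open>z\<zeta>\<close>, \<open>\<zeta>\<close> running through the roots of unity of
  order \<open>2 ^ k\<close>, hence equals \<open>(1 - (z a) ^ (2 ^ k))\<close> inverted; averaging does not increase the
  modulus of continuity of \<open>f\<close>.\<close>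

lemma selfadjoint_norm_attained_spectrum:
  assumes sa: "star a = a"
  shows "\<exists>z\<in>spectrum a. cmod z = norm a"
proof (cases "a = 0")
  case True
  have "0 \<in> spectrum a" unfolding True spectrum_iff unit_elem_def by simp
  with True show ?thesis by force
next
  case False
  define n where "n = norm a"
  define R where "R = 1 / n"
  have n: "n > 0" using False by (simp add: n_def)
  then have R: "R > 0" by (simp add: R_def)
  show ?thesis
  proof (rule ccontr)
    assume no: "\<not> ?thesis"
    have "unit_elem (1 - scaleC z a)" if z: "z \<in> cball 0 R" for z
    proof (cases "z = 0")
      case True
      then show ?thesis by (simp add: unit_elem_def)
    next
      case False
      have "cmod (inverse z) \<ge> n"
        using z False n by (simp add: R_def norm_inverse norm_divide field_simps)
      then have "inverse z \<notin> spectrum a"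
        using no spectrum_norm_le[of "inverse z" a] unfolding n_def by force
      then have "unit_elem (scaleC z (scaleC (inverse z) 1 - a))"
        using False by (simp add: spectrum_iff unit_elem_scaleC)
      then show ?thesis using False by (simp add: scaleC_diff_right scaleC_scaleC)
    qed
    then obtain f where f: "(1 - scaleC z a) * f z = 1 \<and> f z * (1 - scaleC z a) = 1"
        if "z \<in> cball 0 R" for z
      unfolding unit_elem_def by metis
    have "uniformly_continuous_on (cball 0 R) f"
      using continuous_on_resolvent[of "cball 0 R" a f, OF f]
      by (intro compact_uniformly_continuous) auto
    then obtain d where d: "d > 0"
      and dd: "\<And>z w. z \<in> cball 0 R \<Longrightarrow> w \<in> cball 0 R \<Longrightarrow> dist w z < d \<Longrightarrow> dist (f w) (f z) < 1/4"
      unfolding uniformly_continuous_on_def by (metis zero_less_divide_1_iff zero_less_numeral)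
    \<comment> \<open>Shrinking the disc by the factor \<open>s\<close> displaces its points by at
      most \<open>(1 - s) * R < d\<close>, so \<open>f\<close> changes by less than 1/4; the 1/2
      keeps \<open>s\<close> positive when \<open>d\<close> is large.\<close>
    define s where "s = max (1/2) (1 - d / (2 * R))"
    have s: "0 < s" "s < 1" "(1 - s) * R < d"
    proof -
      show "0 < s" "s < 1" using d R by (auto simp: s_def)
      have "1 - s \<le> d / (2 * R)" by (simp add: s_def)
      then have "(1 - s) * R \<le> d / (2 * R) * R" by (rule mult_right_mono) (use R in simp)
      then show "(1 - s) * R < d" using d R by simp
    qed
    \<comment> \<open>\<open>\<zeta> k\<close> has order \<open>2 ^ (k + 1)\<close>, so
      \<open>z\<close> and \<open>\<zeta> k * z\<close> together double the set of averaged points.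
      Since \<open>\<zeta> k ^ (2 ^ k) = -1\<close>, the second mean inverts
      \<open>1 + X k z\<close>, and the mean of the inverses of \<open>1 - x\<close> and
      \<open>1 + x\<close> is the inverse of \<open>1 - x * x\<close>.\<close>
    define \<zeta> where "\<zeta> k = cis (pi / 2 ^ k)" for k :: nat
    have zk: "\<zeta> k ^ (2 ^ k) = -1" for k
      unfolding \<zeta>_def by (simp add: Complex.DeMoivre)
    have zn [simp]: "cmod (\<zeta> k) = 1" for k by (simp add: \<zeta>_def)
    define A where "A = rec_nat f (\<lambda>k B z. (1/2) *\<^sub>R (B z + B (\<zeta> k * z)))"
    have A0: "A 0 z = f z" and AS: "A (Suc k) z = (1/2) *\<^sub>R (A k z + A k (\<zeta> k * z))" for k z
      by (simp_all add: A_def)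
    define X where "X k z = (scaleC z a) ^ (2 ^ k)" for k :: nat and z
    have XA: "(1 - X k z) * A k z = 1" if "z \<in> cball 0 R" for k and z :: complex
      using that
    proof (induction k arbitrary: z)
      case 0
      then show ?case using f by (simp add: X_def A0)
    next
      case (Suc k)
      have Xz: "X k (\<zeta> k * z) = - X k z"
        by (simp add: X_def scaleC_power power_mult_distrib zk scaleC_minus_left)
      have XS: "X (Suc k) z = X k z * X k z"
        by (simp add: X_def power_add[symmetric] mult_2)
      have 1: "(1 - X k z) * A k z = 1" using Suc by simp
      have 2: "(1 + X k z) * A k (\<zeta> k * z) = 1"
        using Suc.IH[of "\<zeta> k * z"] Suc.prems by (simp add: Xz norm_mult)
      have "(1 - X (Suc k) z) * (A k z + A k (\<zeta> k * z))
          = (1 + X k z) * ((1 - X k z) * A k z) + (1 - X k z) * ((1 + X k z) * A k (\<zeta> k * z))"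
        by (simp add: XS algebra_simps)
      also have "\<dots> = 2 *\<^sub>R 1" by (simp only: 1 2) (simp add: scaleR_2)
      finally show ?case by (simp add: AS)
    qed
    have Ad: "norm (A k z - A k (s * z)) \<le> 1/4" if "z \<in> cball 0 R" for k and z :: complex
      using that
    proof (induction k arbitrary: z)
      case 0
      have "cmod (s * z) \<le> R"
        using 0 s by (simp add: norm_mult) (meson less_imp_le mult_left_le_one_le norm_ge_zero order_trans)
      moreover have "dist z (s * z) < d"
      proof -
        have "z - s * z = of_real (1 - s) * z" by (simp add: algebra_simps)
        then have "dist z (s * z) = (1 - s) * cmod z"
          using s by (simp add: dist_norm norm_mult del: of_real_diff)
        also have "\<dots> \<le> (1 - s) * R" using 0 s by (intro mult_left_mono) auto
        finally show ?thesis using s by simp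
      qed
      ultimately have "dist (f z) (f (s * z)) < 1/4" using 0 by (intro dd) simp_all
      then show ?case by (simp add: A0 dist_norm)
    next
      case (Suc k)
      have 1: "norm (A k z - A k (s * z)) \<le> 1/4" using Suc by simp
      have 2: "norm (A k (\<zeta> k * z) - A k (s * (\<zeta> k * z))) \<le> 1/4"
        using Suc.IH[of "\<zeta> k * z"] Suc.prems by (simp add: norm_mult)
      have "A (Suc k) z - A (Suc k) (s * z) = (1/2) *\<^sub>R ((A k z - A k (s * z))
          + (A k (\<zeta> k * z) - A k (s * (\<zeta> k * z))))"
        by (simp add: AS algebra_simps)
      also have "norm \<dots> \<le> 1/4"
        using norm_triangle_mono[OF 1 2] by simp
      finally show ?case .
    qed
    have "(\<lambda>k. s ^ k) \<longlonglongrightarrow> 0" using s by (intro LIMSEQ_realpow_zero) auto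
    then have "eventually (\<lambda>k. s ^ k < 1/8) sequentially" by (rule order_tendstoD) simp
    then obtain k where k: "s ^ k < 1/8" by (auto simp: eventually_sequentially)
    have "s ^ (2 ^ k) \<le> s ^ k" using s by (intro power_decreasing) auto
    with k have sk: "s ^ (2 ^ k) < 1/8" by simp
    define x where "x = X k R"
    define x' where "x' = X k (s * R)"
    \<comment> \<open>At radius \<open>R = 1 / norm a\<close> the powers have norm 1 for every
      \<open>k\<close>, at radius \<open>s * R\<close> they tend to 0. So \<open>B'\<close> is
      within 1/7 of 1 and \<open>B\<close> within 1/7 + 1/4 < 1/2; but
      \<open>x = (B - 1) - x * (B - 1)\<close> has norm at most
      \<open>2 * norm (B - 1)\<close>.\<close>
    have nx: "norm x = 1"
      using R n by (simp add: x_def X_def scaleC_power norm_scaleC norm_power norm_power_selfadjoint[OF sa]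
          flip: n_def power_mult_distrib) (simp add: R_def)
    have "x' = (s ^ (2 ^ k)) *\<^sub>R x"
      by (simp add: x'_def x_def X_def scaleC_power power_mult_distrib scaleC_scaleC flip: scaleC_of_real)
    then have nx': "norm x' < 1/8" using nx sk s by simp
    define B where "B = A k R"
    define B' where "B' = A k (s * R)"
    have Rin: "of_real R \<in> cball (0::complex) R" using R by simp
    have sRin: "of_real s * of_real R \<in> cball (0::complex) R"
      using R s by (simp add: norm_mult)
    have B: "x * B = B - 1"
      using XA[OF Rin, of k] by (simp add: x_def B_def algebra_simps)
    have B': "B' - 1 = x' * B'"
      using XA[OF sRin, of k] by (simp add: x'_def B'_def algebra_simps)
    have BB: "norm (B - B') \<le> 1/4" using Ad[OF Rin, of k] by (simp add: B_def B'_def)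
    have "norm (B' - 1) \<le> 1/8 * norm B'"
      unfolding B' using norm_mult_ineq[of x' B'] nx' mult_right_mono[of "norm x'" "1/8" "norm B'"] by simp
    moreover have "norm B' \<le> norm (B' - 1) + 1" using norm_triangle_ineq[of "B' - 1" 1] by simp
    ultimately have "norm (B' - 1) \<le> 1/7" by simp
    then have e: "norm (B - 1) < 1/2"
      using norm_triangle_ineq[of "B - B'" "B' - 1"] BB by simp
    have "x = (B - 1) - x * (B - 1)" using B by (simp add: algebra_simps)
    then have "norm x \<le> norm (B - 1) + norm (x * (B - 1))" by (metis norm_triangle_ineq4)
    also have "norm (x * (B - 1)) \<le> norm (B - 1)" using norm_mult_ineq[of x "B - 1"] nx by simp
    finally show False using nx e by simp
  qed
qed

section \<open>Positive elements\<close>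

lemma positive_elemD:
  assumes "positive_elem a"
  shows "star a = a" and "z \<in> spectrum a \<Longrightarrow> \<exists>r\<ge>0. z = complex_of_real r"
  using assms unfolding positive_elem_def by auto

text \<open>A real spectrum within distance \<open>t\<close> of \<open>t\<close> lies in
  \<open>[0, 2 * t]\<close>. With the converse \<open>positive_elem_norm_D\<close> this trades the
  spectral definition for a norm inequality, which passes to limits and, by the triangle inequality,
  to sums.\<close>

lemma positive_elem_norm_I:
  assumes a: "star a = a" and t: "norm (of_real t - a) \<le> t"
  shows "positive_elem a"
  unfolding positive_elem_def
proof (intro conjI subsetI a)
  fix z assume z: "z \<in> spectrum a"
  then have z': "z = of_real (Re z)" using spectrum_selfadjoint_real[OF a z] by (simp add: complex_eq_iff)
  have "of_real t - z \<in> spectrum (of_real t - a)" using z by (simp add: spectrum_of_real_minus)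
  then have "cmod (of_real t - z) \<le> t" using spectrum_norm_le t order_trans by blast
  moreover have "of_real t - z = of_real (t - Re z)"
    using spectrum_selfadjoint_real[OF a z] by (simp add: complex_eq_iff)
  ultimately have "cmod (of_real (t - Re z)) \<le> t" by simp
  then have "\<bar>t - Re z\<bar> \<le> t" by (simp only: norm_of_real)
  then have "Re z \<ge> 0" by simp
  then show "z \<in> complex_of_real ` {0..}" using z' by (metis atLeast_iff imageI)
qed

lemma positive_elem_norm_D:
  assumes a: "positive_elem a" and t: "norm a \<le> t"
  shows "norm (of_real t - a) \<le> t"
proof -
  have "star (of_real t - a) = of_real t - a" using positive_elemD(1)[OF a] by (simp add: star_diff)
  then obtain z where z: "z \<in> spectrum (of_real t - a)" "cmod z = norm (of_real t - a)"
    using selfadjoint_norm_attained_spectrum by blast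
  have za: "of_real t - z \<in> spectrum a"
    using z(1) spectrum_of_real_minus[of t "of_real t - z" a] by simp
  then obtain r where r: "r \<ge> 0" "of_real t - z = of_real r" using positive_elemD(2)[OF a] by blast
  have "r \<le> t" using spectrum_norm_le[OF za] r t by simp
  moreover have "z = of_real t - of_real r" by (simp flip: r(2))
  then have "z = of_real (t - r)" by simp
  then have "cmod z = \<bar>t - r\<bar>" by (simp only: norm_of_real)
  ultimately show ?thesis using z(2) r(1) by simp
qed

lemma positive_elem_iff:
  "positive_elem a \<longleftrightarrow> star a = a \<and> norm (of_real (norm a) - a) \<le> norm a"
  using positive_elem_norm_I[of a "norm a"] positive_elem_norm_D[of a "norm a"] positive_elemD(1)[of a]
  by auto

lemma closed_positive_elem: "closed {a::'a::unital_cstar_algebra. positive_elem a}"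
proof -
  have "continuous_on UNIV (star :: 'a \<Rightarrow> 'a)"
    by (rule linear_continuous_on[OF bounded_linear_star])
  then show ?thesis
    unfolding positive_elem_iff
    by (intro closed_Collect_conj closed_Collect_eq closed_Collect_le continuous_intros)
qed

lemma positive_elem_tendsto:
  assumes "(f \<longlongrightarrow> a) F" "eventually (\<lambda>x. positive_elem (f x)) F" "F \<noteq> bot"
  shows "positive_elem a"
  using Lim_in_closed_set[OF closed_positive_elem _ assms(3,1)] assms(2) by simp

lemma positive_elem_add:
  assumes "positive_elem a" "positive_elem b"
  shows "positive_elem (a + b)"
proof (rule positive_elem_norm_I)
  show "star (a + b) = a + b" using assms by (simp add: positive_elemD star_add)
  have "of_real (norm a + norm b) - (a + b) = (of_real (norm a) - a) + (of_real (norm b) - b)" by simp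
  also have "norm \<dots> \<le> norm a + norm b"
    using assms by (intro norm_triangle_mono) (simp_all add: positive_elem_norm_D)
  finally show "norm (of_real (norm a + norm b) - (a + b)) \<le> norm a + norm b" .
qed

lemma positive_elem_zero [simp]: "positive_elem 0"
  by (simp add: positive_elem_iff)

lemma positive_elem_sum:
  "(\<And>j. j \<in> F \<Longrightarrow> positive_elem (f j)) \<Longrightarrow> positive_elem (\<Sum>j\<in>F. f j)"
  by (induction F rule: infinite_finite_induct) (auto intro: positive_elem_add)

lemma positive_elem_scaleR:
  assumes "positive_elem a" "r \<ge> 0"
  shows "positive_elem (r *\<^sub>R a)"
proof (rule positive_elem_norm_I)
  show "star (r *\<^sub>R a) = r *\<^sub>R a" using assms by (simp add: positive_elemD star_scaleR)
  have "of_real (r * norm a) - r *\<^sub>R a = r *\<^sub>R (of_real (norm a) - a)"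
    by (simp add: of_real_def algebra_simps)
  also have "norm \<dots> \<le> r * norm a"
    using assms by (simp add: positive_elem_norm_D mult_left_mono)
  finally show "norm (of_real (r * norm a) - r *\<^sub>R a) \<le> r * norm a" .
qed

lemma positive_elem_of_real [simp]: "r \<ge> 0 \<Longrightarrow> positive_elem (of_real r)"
  by (simp add: positive_elem_iff)

lemma of_real_norm_minus_positive:
  assumes a: "star a = a" and t: "norm a \<le> t"
  shows "positive_elem (of_real t - a)"
  using a t by (intro positive_elem_norm_I[where t = t]) (simp_all add: star_diff)

lemma norm_le_of_positive_minus:
  assumes "positive_elem a" "positive_elem (of_real t - a)"
  shows "norm a \<le> t"
proof -
  obtain z where z: "z \<in> spectrum a" "cmod z = norm a"
    using selfadjoint_norm_attained_spectrum positive_elemD(1)[OF assms(1)] by blast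
  obtain r where r: "r \<ge> 0" "z = of_real r" using positive_elemD(2)[OF assms(1) z(1)] by blast
  have "of_real t - z \<in> spectrum (of_real t - a)" using z(1) by (simp add: spectrum_of_real_minus)
  then obtain s where "s \<ge> 0" "of_real t - z = of_real s" using positive_elemD(2)[OF assms(2)] by blast
  then have "complex_of_real (t - r) = of_real s" using r by simp
  then have "t - r = s" by (simp only: of_real_eq_iff)
  then show ?thesis using z(2) r \<open>s \<ge> 0\<close> by simp
qed

text \<open>\<open>of_real (norm b) - a\<close> is the sum of the positive elements
  \<open>of_real (norm b) - b\<close> and \<open>b - a\<close>.\<close>

lemma norm_mono_positive:
  assumes "positive_elem a" "positive_elem (b - a)"
  shows "norm a \<le> norm b"
proof -
  have "star b = b"
    using positive_elemD(1)[OF positive_elem_add[OF assms]] by simp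
  then have "positive_elem (of_real (norm b) - b)" by (rule of_real_norm_minus_positive) simp
  from positive_elem_add[OF this assms(2)]
  show ?thesis using assms(1) by (intro norm_le_of_positive_minus) simp_all
qed

lemma positive_elem_antisym:
  assumes "positive_elem a" "positive_elem (- a)"
  shows "a = 0"
  using norm_mono_positive[OF assms(1), of 0] assms(2) by simp

text \<open>A spectral value \<open>- s * s\<close> with \<open>s > 0\<close> would make
  \<open>h * h + s * s\<close> singular; but this factors as
  \<open>(\<i> * s - h) * (- \<i> * s - h)\<close>, and both factors are invertible because the
  spectrum of \<open>h\<close> is real.\<close>

lemma positive_elem_square:
  assumes h: "star h = h"
  shows "positive_elem (h * h)"
  unfolding positive_elem_def
proof (intro conjI subsetI)
  show hh: "star (h * h) = h * h" using h by (simp add: star_mult)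
  fix z assume z: "z \<in> spectrum (h * h)"
  have z': "z = of_real (Re z)"
    using spectrum_selfadjoint_real[OF hh z] by (simp add: complex_eq_iff)
  have "Re z \<ge> 0"
  proof (rule ccontr)
    assume "\<not> Re z \<ge> 0"
    define s where "s = sqrt (- Re z)"
    have s: "s > 0" "s * s = - Re z" using \<open>\<not> Re z \<ge> 0\<close> by (simp_all add: s_def)
    have "\<i> * s \<notin> spectrum h" "- \<i> * s \<notin> spectrum h"
      using spectrum_selfadjoint_real[OF h, of "\<i> * s"] spectrum_selfadjoint_real[OF h, of "- \<i> * s"] s
      by auto
    then have "unit_elem ((scaleC (\<i> * s) 1 - h) * (scaleC (- \<i> * s) 1 - h))"
      by (intro unit_elem_mult) (simp_all add: spectrum_iff)
    moreover have "(scaleC (\<i> * s) 1 - h) * (scaleC (- \<i> * s) 1 - h) = scaleC (s * s) 1 + h * h"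
      by (simp add: algebra_simps scaleC_mult_left scaleC_mult_right scaleC_scaleC scaleC_minus_left
          scaleC_diff_right)
    moreover have "scaleC (s * s) 1 + h * h = - (scaleC z 1 - h * h)"
      by (subst z') (simp add: s scaleC_minus_left flip: of_real_mult)
    ultimately show False
      using z unit_elem_minus_commute[of "h * h" "scaleC z 1"] by (simp add: spectrum_iff)
  qed
  then show "z \<in> complex_of_real ` {0..}" using z' by (metis atLeast_iff imageI)
qed

text \<open>With \<open>x = 1 - p\<close>, a fixed point \<open>l\<close> of
  \<open>y \<mapsto> (x + y * y) / 2\<close> satisfies \<open>(1 - l) * (1 - l) = p\<close>. The
  iterates are polynomials in \<open>p\<close>, so the limit commutes with everything that commutes
  with \<open>p\<close>.\<close>

lemma positive_elem_sqrt_contraction: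
  assumes p: "positive_elem p" and np: "norm p \<le> 1"
  shows "\<exists>q. positive_elem q \<and> q * q = p \<and> (\<forall>c. c * p = p * c \<longrightarrow> c * q = q * c)"
proof -
  define x where "x = 1 - p"
  have x: "star x = x" "norm x \<le> 1"
    using p np positive_elem_norm_D[OF p np] by (simp_all add: x_def star_diff positive_elemD)
  define y where "y = rec_nat 0 (\<lambda>_ u. (1/2) *\<^sub>R (x + u * u))"
  \<comment> \<open>The same iteration for the scalar \<open>x = 1\<close> increases and stays below
    or at 1; it dominates the iterates \<open>y\<close> and their increments, so the telescoping
    series of \<open>y\<close> converges.\<close>
  define t :: "nat \<Rightarrow> real" where "t = rec_nat 0 (\<lambda>_ u. (1 + u * u) / 2)"
  have y0: "y 0 = 0" and yS: "y (Suc n) = (1/2) *\<^sub>R (x + y n * y n)" for n by (simp_all add: y_def)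
  have t0: "t 0 = 0" and tS: "t (Suc n) = (1 + t n * t n) / 2" for n by (simp_all add: t_def)
  have t1: "0 \<le> t n \<and> t n \<le> 1" for n
    by (induction n) (auto simp: t0 tS intro: mult_le_one)
  have yt: "norm (y n) \<le> t n" for n
  proof (induction n)
    case (Suc n)
    have "norm (y n * y n) \<le> t n * t n"
      using Suc t1[of n] by (meson mult_mono norm_ge_zero norm_mult_ineq order_trans)
    then have "norm (x + y n * y n) \<le> 1 + t n * t n" using x(2) by (intro norm_triangle_mono)
    then show ?case by (simp add: yS tS)
  qed (simp add: y0 t0)
  have yd: "norm (y (Suc n) - y n) \<le> t (Suc n) - t n" for n
  proof (induction n)
    case 0
    then show ?case using yt[of 1] by (simp add: y0 t0)
  next
    case (Suc n)
    have "y (Suc n) * y (Suc n) - y n * y n = y (Suc n) * (y (Suc n) - y n) + (y (Suc n) - y n) * y n"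
      by (simp add: algebra_simps)
    also have "norm \<dots> \<le> t (Suc n) * (t (Suc n) - t n) + (t (Suc n) - t n) * t n"
    proof (rule norm_triangle_mono)
      have "0 \<le> t (Suc n) - t n" by (rule order_trans[OF norm_ge_zero Suc.IH])
      then show "norm (y (Suc n) * (y (Suc n) - y n)) \<le> t (Suc n) * (t (Suc n) - t n)"
        "norm ((y (Suc n) - y n) * y n) \<le> (t (Suc n) - t n) * t n"
        using t1 by (auto intro!: order_trans[OF norm_mult_ineq] mult_mono[OF yt Suc.IH] mult_mono[OF Suc.IH yt])
    qed
    finally have 1: "norm (y (Suc n) * y (Suc n) - y n * y n) \<le> t (Suc n) * t (Suc n) - t n * t n"
      by (simp add: algebra_simps)
    have "y (Suc (Suc n)) - y (Suc n)
        = (1/2) *\<^sub>R (x + y (Suc n) * y (Suc n)) - (1/2) *\<^sub>R (x + y n * y n)"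
      by (simp only: yS)
    also have "\<dots> = (1/2) *\<^sub>R (y (Suc n) * y (Suc n) - y n * y n)" by (simp add: algebra_simps)
    finally have "norm (y (Suc (Suc n)) - y (Suc n)) \<le> (t (Suc n) * t (Suc n) - t n * t n) / 2"
      using 1 by simp
    also have "\<dots> = (1 + t (Suc n) * t (Suc n)) / 2 - (1 + t n * t n) / 2"
      by (simp add: diff_divide_distrib add_divide_distrib)
    also have "\<dots> = t (Suc (Suc n)) - t (Suc n)" by (simp only: tS)
    finally show ?case .
  qed
  have "t n \<le> t (Suc n)" for n using order_trans[OF norm_ge_zero yd[of n]] by simp
  then have "monoseq t" unfolding monoseq_Suc by blast
  moreover have "Bseq t" by (rule BseqI'[where K = 1]) (use t1 in auto)
  ultimately have "convergent t" by (intro Bseq_monoseq_convergent)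
  then have "summable (\<lambda>n. t (Suc n) - t n)"
    using telescope_summable unfolding convergent_def by blast
  then have "summable (\<lambda>n. y (Suc n) - y n)"
    by (rule summable_comparison_test'[where N = 0]) (use yd in auto)
  then have "convergent (\<lambda>n. \<Sum>k<n. y (Suc k) - y k)" by (simp add: summable_iff_convergent)
  then have "convergent y" by (simp add: sum_lessThan_telescope y0)
  then obtain l where l: "y \<longlonglongrightarrow> l" unfolding convergent_def by blast
  define q where "q = 1 - l"
  have "(\<lambda>n. (1/2) *\<^sub>R (x + y n * y n)) \<longlonglongrightarrow> (1/2) *\<^sub>R (x + l * l)"
    by (intro tendsto_intros l)
  moreover have "(\<lambda>n. (1/2) *\<^sub>R (x + y n * y n)) \<longlonglongrightarrow> l"
    using LIMSEQ_Suc[OF l] by (simp add: yS)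
  ultimately have "(1/2) *\<^sub>R (x + l * l) = l" by (rule LIMSEQ_unique)
  then have "2 *\<^sub>R ((1/2) *\<^sub>R (x + l * l)) = 2 *\<^sub>R l" by (rule arg_cong)
  then have "x + l * l = l + l" by (simp add: scaleR_2)
  then have "x = l + l - l * l" by (simp add: eq_diff_eq)
  moreover have "p = 1 - x" by (simp add: x_def)
  ultimately have qq: "q * q = p" by (simp add: q_def left_diff_distrib right_diff_distrib)
  have ys: "star (y n) = y n" for n
    by (induction n) (simp_all add: y0 yS star_scaleR star_add star_mult x(1))
  have "(\<lambda>n. star (y n)) \<longlonglongrightarrow> star l" by (rule bounded_linear.tendsto[OF bounded_linear_star l])
  then have ls: "star l = l" using l by (simp add: ys LIMSEQ_unique)
  have "norm (y n) \<le> 1" for n using yt[of n] t1[of n] by linarith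
  then have "norm l \<le> 1" by (intro LIMSEQ_le_const2[OF tendsto_norm[OF l]]) auto
  then have "positive_elem q"
    using ls by (intro positive_elem_norm_I[where t = 1]) (simp_all add: q_def star_diff)
  moreover have "c * q = q * c" if c: "c * p = p * c" for c
  proof -
    have cx: "c * x = x * c" using c by (simp add: x_def algebra_simps)
    have "c * y n = y n * c" for n
    proof (induction n)
      case (Suc n)
      have "c * (y n * y n) = y n * y n * c" using Suc by (metis mult.assoc)
      then show ?case by (simp add: yS cx algebra_simps)
    qed (simp add: y0)
    then have "(\<lambda>n. y n * c) \<longlonglongrightarrow> c * l" using tendsto_mult_left[OF l, of c] by simp
    moreover have "(\<lambda>n. y n * c) \<longlonglongrightarrow> l * c" by (intro tendsto_intros l)
    ultimately have "c * l = l * c" by (rule LIMSEQ_unique)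
    then show ?thesis by (simp add: q_def algebra_simps)
  qed
  ultimately show ?thesis using qq by blast
qed

lemma positive_elem_sqrt:
  assumes p: "positive_elem p"
  obtains q where "positive_elem q" "q * q = p" "\<And>c. c * p = p * c \<Longrightarrow> c * q = q * c"
proof -
  define n where "n = norm p + 1"
  have n: "n > 0" "norm p \<le> n" unfolding n_def by (simp_all add: add_nonneg_pos)
  have 1: "positive_elem ((1/n) *\<^sub>R p)" using n(1) p by (intro positive_elem_scaleR) simp_all
  have 2: "norm ((1/n) *\<^sub>R p) \<le> 1" using n by (simp add: divide_le_eq)
  obtain q where q: "positive_elem q \<and> q * q = (1/n) *\<^sub>R p \<and>
      (\<forall>c. c * ((1/n) *\<^sub>R p) = ((1/n) *\<^sub>R p) * c \<longrightarrow> c * q = q * c)"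
    using positive_elem_sqrt_contraction[OF 1 2] by (rule exE)
  show thesis
  proof (rule that[of "sqrt n *\<^sub>R q"])
    show "positive_elem (sqrt n *\<^sub>R q)" using n(1) q by (intro positive_elem_scaleR) simp_all
    have "(sqrt n *\<^sub>R q) * (sqrt n *\<^sub>R q) = (sqrt n * sqrt n) *\<^sub>R (q * q)" by simp
    also have "\<dots> = n *\<^sub>R ((1/n) *\<^sub>R p)" using n(1) q by simp
    also have "\<dots> = p" using n(1) by simp
    finally show "(sqrt n *\<^sub>R q) * (sqrt n *\<^sub>R q) = p" .
    fix c assume "c * p = p * c"
    then have "c * ((1/n) *\<^sub>R p) = ((1/n) *\<^sub>R p) * c" by simp
    then have "c * q = q * c" using q by blast
    then show "c * (sqrt n *\<^sub>R q) = (sqrt n *\<^sub>R q) * c" by simp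
  qed
qed

text \<open>If \<open>c\<close> inverts \<open>z - a * b\<close>, then
  \<open>(1 + b * c * a) / z\<close> inverts \<open>z - b * a\<close>.\<close>

lemma spectrum_mult_commute:
  assumes "z \<noteq> 0" "z \<in> spectrum (b * a)" shows "z \<in> spectrum (a * b)"
proof (rule ccontr)
  assume "\<not> ?thesis"
  then obtain c where c: "(scaleC z 1 - a * b) * c = 1" "c * (scaleC z 1 - a * b) = 1"
    unfolding spectrum_iff unit_elem_def by blast
  have "(scaleC z 1 - b * a) * (1 + b * c * a) = scaleC z 1 - b * a + b * ((scaleC z 1 - a * b) * c) * a"
    by (simp add: algebra_simps scaleC_mult_left scaleC_mult_right scaleC_add_right)
  then have 1: "(scaleC z 1 - b * a) * (1 + b * c * a) = scaleC z 1" using c by simp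
  have "(1 + b * c * a) * (scaleC z 1 - b * a) = scaleC z 1 - b * a + b * (c * (scaleC z 1 - a * b)) * a"
    by (simp add: algebra_simps scaleC_mult_left scaleC_mult_right scaleC_add_right)
  then have 2: "(1 + b * c * a) * (scaleC z 1 - b * a) = scaleC z 1" using c by simp
  have "unit_elem (scaleC z 1 - b * a)"
    using 1 2 assms(1)
    by (intro unit_elem_left_right[where b = "scaleC (inverse z) (1 + b * c * a)"
          and c = "scaleC (inverse z) (1 + b * c * a)"])
      (simp_all add: scaleC_mult_left scaleC_mult_right scaleC_scaleC)
  then show False using assms(2) by (simp add: spectrum_iff)
qed

text \<open>With \<open>c = x\<^sup>* x\<close>, \<open>v = \<bar>c\<bar>\<close> and \<open>w = v - c\<close> (twice the negative part of \<open>c\<close>), the element \<open>y = x w\<close>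
  satisfies \<open>y\<^sup>* y = - v w\<^sup>2 \<le> 0\<close>, while \<open>y\<^sup>* y + y y\<^sup>*\<close> is a sum of squares; as \<open>y\<^sup>* y\<close> and \<open>y y\<^sup>*\<close> have the same
  nonzero spectrum, \<open>y\<^sup>* y = 0\<close> and then \<open>w = 0\<close>.\<close>

lemma positive_elem_star_mult: "positive_elem (star x * x)"
proof -
  define c where "c = star x * x"
  have c: "star c = c" by (simp add: c_def star_mult star_star)
  obtain v where v: "positive_elem v" "v * v = c * c" "\<And>d. d * (c * c) = (c * c) * d \<Longrightarrow> d * v = v * d"
    using positive_elem_sqrt[OF positive_elem_square[OF c]] by blast
  \<comment> \<open>The root of \<open>v\<close> turns \<open>w * v * w\<close> into the square of
    the self-adjoint \<open>r * w\<close>, so \<open>positive_elem_square\<close> suffices;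
    positivity of conjugates and of commuting products rests on the present lemma.\<close>
  obtain r where r: "positive_elem r" "r * r = v" "\<And>d. d * v = v * d \<Longrightarrow> d * r = r * d"
    using positive_elem_sqrt[OF v(1)] by blast
  have cv: "c * v = v * c" by (rule v(3)) (simp add: mult.assoc)
  have cr: "c * r = r * c" by (rule r(3)) (rule cv)
  have vr: "v * r = r * v" by (rule r(3)) simp
  define w where "w = v - c"
  have w: "star w = w" by (simp add: w_def star_diff positive_elemD(1)[OF v(1)] c)
  have wr: "w * r = r * w" by (simp add: w_def algebra_simps cr vr)
  have wv: "w * v = v * w" by (simp add: w_def algebra_simps cv)
  have cw: "c * w = - (v * w)" by (simp add: w_def algebra_simps cv v(2))
  have ww: "w * w = 2 *\<^sub>R (v * w)"
  proof -
    have "w * w = v * w - c * w" by (simp add: w_def algebra_simps)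
    then show ?thesis by (simp add: cw scaleR_2)
  qed
  define y where "y = x * w"
  have "star y * y = w * (c * w)" by (simp add: y_def c_def star_mult w mult.assoc)
  also have "\<dots> = - (w * (r * r * w))" by (simp add: cw r(2))
  also have "w * (r * r * w) = (r * w) * (r * w)" by (metis wr mult.assoc)
  finally have yy: "star y * y = - ((r * w) * (r * w))" .
  have srw: "star (r * w) = r * w" by (simp add: star_mult w positive_elemD(1)[OF r(1)] wr)
  have neg: "positive_elem (- (star y * y))" using yy positive_elem_square[OF srw] by simp
  define h where "h = y + star y"
  define k where "k = scaleC \<i> (y - star y)"
  have hk: "star h = h" "star k = k"
    by (simp_all add: h_def k_def star_add star_star star_scaleC star_diff scaleC_diff_right scaleC_minus_left)
  have "h * h + k * k = 2 *\<^sub>R (star y * y) + 2 *\<^sub>R (y * star y)"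
    by (simp add: h_def k_def scaleC_mult_left scaleC_mult_right scaleC_scaleC scaleC_minus_left)
      (simp add: algebra_simps scaleR_2)
  then have "y * star y = (1/2) *\<^sub>R (h * h + k * k) + (- (star y * y))"
    by (simp add: algebra_simps)
  then have pos: "positive_elem (y * star y)"
    by (simp only:) (intro positive_elem_add positive_elem_scaleR positive_elem_square hk neg; simp)
  have "star y * y = 0"
  proof -
    obtain z where z: "z \<in> spectrum (star y * y)" "cmod z = norm (star y * y)"
      using selfadjoint_norm_attained_spectrum[of "star y * y"] by (auto simp: star_mult star_star)
    have "- z \<in> spectrum (- (star y * y))" using z(1) by (simp add: spectrum_uminus)
    then obtain s where s: "s \<ge> 0" "- z = of_real s" using positive_elemD(2)[OF neg] by blast
    have "z = 0"
    proof (rule ccontr)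
      assume "z \<noteq> 0"
      then have "z \<in> spectrum (y * star y)" using spectrum_mult_commute z(1) by blast
      then obtain s' where s': "s' \<ge> 0" "z = of_real s'" using positive_elemD(2)[OF pos] by blast
      then have "complex_of_real (s + s') = 0" using s by (simp flip: s(2))
      then have "s + s' = 0" by (simp only: of_real_eq_0_iff)
      then show False using s(1) s' \<open>z \<noteq> 0\<close> by simp
    qed
    then show ?thesis using z(2) by simp
  qed
  then have "r * w = 0" using yy square_eq_0_iff[OF srw] by simp
  then have "v * w = 0" using r(2) by (metis mult.assoc mult_zero_right)
  then have "w = 0" using ww square_eq_0_iff[OF w] by simp
  then show ?thesis using v(1) by (simp add: w_def c_def)
qed

lemma positive_elem_mult_star: "positive_elem (x * star x)"
  using positive_elem_star_mult[of "star x"] by (simp add: star_star)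

lemma positive_elem_conjugate:
  assumes "positive_elem p" shows "positive_elem (x * p * star x)"
proof -
  obtain q where q: "positive_elem q" "q * q = p" using positive_elem_sqrt[OF assms] by blast
  have "x * p * star x = (x * q) * star (x * q)"
    by (simp add: star_mult mult.assoc positive_elemD(1)[OF q(1)] flip: q(2))
  then show ?thesis using positive_elem_mult_star[of "x * q"] by simp
qed

lemma positive_elem_mult:
  assumes "positive_elem p" "positive_elem q" "p * q = q * p"
  shows "positive_elem (p * q)"
proof -
  obtain r where r: "positive_elem r" "r * r = p" "\<And>c. c * p = p * c \<Longrightarrow> c * r = r * c"
    using positive_elem_sqrt[OF assms(1)] by blast
  have "q * r = r * q" using r(3)[of q] assms(3) by simp
  then have "p * q = r * q * star r"
    by (simp add: positive_elemD(1)[OF r(1)] mult.assoc flip: r(2))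
  then show ?thesis using positive_elem_conjugate[OF assms(2), of r] by simp
qed

text \<open>For \<open>p, c \<ge> 0\<close> with \<open>p\<^sup>2 = c\<^sup>2\<close> and \<open>d = p - c\<close>, \<open>d p d\<close> and \<open>d c d\<close> are positive with sum \<open>0\<close>,
  so both vanish and \<open>d\<^sup>3 = 0\<close>.\<close>

lemma cstar_abs_positive_central:
  assumes c: "positive_elem c" and z: "c \<in> algebra_center"
  shows "cstar_abs c = c"
  unfolding cstar_abs_def
proof (rule the_equality)
  show "positive_elem c \<and> c * c = star c * c" using c by (simp add: positive_elemD(1)[OF c])
  fix p assume "positive_elem p \<and> p * p = star c * c"
  then have p: "positive_elem p" "p * p = c * c" using positive_elemD(1)[OF c] by simp_all
  define d where "d = p - c"
  have d: "star d = d" by (simp add: d_def star_diff positive_elemD(1)[OF c] positive_elemD(1)[OF p(1)])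
  have "c * p = p * c" using z by (simp add: algebra_center_def)
  then have "d * (p + c) = 0"
    by (simp add: d_def left_diff_distrib distrib_left p(2))
  moreover have "d * p * d + d * c * d = (d * (p + c)) * d" by (simp add: distrib_left distrib_right)
  ultimately have 0: "d * p * d + d * c * d = 0" by simp
  have 1: "positive_elem (d * p * d)" "positive_elem (d * c * d)"
    using positive_elem_conjugate[OF p(1), of d] positive_elem_conjugate[OF c, of d] d by simp_all
  have "- (d * p * d) = d * c * d" using 0 by (rule minus_unique)
  then have 2: "d * p * d = 0" using 1 positive_elem_antisym[of "d * p * d"] by simp
  then have "d * c * d = 0" using 0 by simp
  moreover have "d * d * d = d * p * d - d * c * d"
    unfolding left_diff_distrib[symmetric] right_diff_distrib[symmetric] by (simp only: d_def)
  ultimately have "d * d * d = 0" using 2 by simp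
  then have "d * d * (d * d) = 0" by (simp flip: mult.assoc)
  then have "d * d = 0" using square_eq_0_iff[of "d * d"] d by (simp add: star_mult)
  then have "d = 0" using square_eq_0_iff[OF d] by simp
  then show "p = c" by (simp add: d_def)
qed

text \<open>Inversion carries the spectrum from \<open>[\<delta>, norm x]\<close> into
  \<open>[1 / norm x, 1 / \<delta>]\<close>. The lower end is recorded as well, since it supplies
  the lower bound of the coefficients.\<close>

lemma positive_elem_inverse:
  assumes d: "\<delta> > 0" and x: "positive_elem (x - of_real \<delta>)"
  obtains y where "x * y = 1" "y * x = 1" "positive_elem y" "norm y \<le> 1 / \<delta>"
    "positive_elem (y - of_real (1 / norm x))"
proof -
  have sx: "star x = x"
    using positive_elemD(1)[OF x] by (simp add: star_diff)
  have spx: "\<exists>r\<ge>\<delta>. z = complex_of_real r" if "z \<in> spectrum x" for z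
  proof -
    have "z - of_real \<delta> \<in> spectrum (x - of_real \<delta>)" using that by (simp add: spectrum_minus_of_real)
    then obtain r where "r \<ge> 0" "z - of_real \<delta> = of_real r" using positive_elemD(2)[OF x] by blast
    then have "r + \<delta> \<ge> \<delta>" "z = complex_of_real (r + \<delta>)" by (simp_all add: diff_eq_eq)
    then show ?thesis by blast
  qed
  have "0 \<notin> spectrum x" using spx[of 0] d by auto
  then have "unit_elem x" by (simp add: spectrum_iff unit_elem_uminus)
  then obtain y where y: "x * y = 1" "y * x = 1" unfolding unit_elem_def by blast
  have sy: "star y = y"
  proof -
    have 1: "star y * x = 1" using arg_cong[OF y(1), of star] by (simp add: star_mult sx)
    have "star y = star y * (x * y)" using y by simp
    also have "\<dots> = y" using 1 by (simp flip: mult.assoc)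
    finally show ?thesis .
  qed
  have x0: "norm x > 0" using y by fastforce
  have spy: "\<exists>r\<ge>1 / norm x. r \<le> 1 / \<delta> \<and> z = complex_of_real r" if z: "z \<in> spectrum y" for z
  proof -
    have "z \<noteq> 0"
    proof
      assume "z = 0"
      then have "\<not> unit_elem y" using z by (simp add: spectrum_iff unit_elem_uminus)
      then show False using y unfolding unit_elem_def by blast
    qed
    have "inverse z \<in> spectrum x"
    proof (rule ccontr)
      assume "inverse z \<notin> spectrum x"
      then have "unit_elem (scaleC (inverse z) 1 - x)" by (simp add: spectrum_iff)
      \<comment> \<open>\<open>- z * (inverse z - x) * y = z - y\<close>, so invertibility of
        \<open>inverse z - x\<close> would pass to \<open>z - y\<close>.\<close>
      then have "unit_elem (scaleC (- z) (scaleC (inverse z) 1 - x))"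
        using \<open>z \<noteq> 0\<close> by (simp only: unit_elem_scaleC neg_equal_0_iff_equal not_False_eq_True)
      then have "unit_elem (scaleC (- z) (scaleC (inverse z) 1 - x) * y)"
        using y by (intro unit_elem_mult) (auto simp: unit_elem_def)
      moreover have "scaleC (- z) (scaleC (inverse z) 1 - x) * y = scaleC z 1 - y"
        using \<open>z \<noteq> 0\<close> by (simp add: scaleC_diff_right scaleC_scaleC left_diff_distrib scaleC_mult_left y
            scaleC_minus_left)
      ultimately show False using z by (simp add: spectrum_iff)
    qed
    then obtain r where r: "r \<ge> \<delta>" "inverse z = of_real r" using spx by blast
    have "r \<le> norm x" using spectrum_norm_le[OF \<open>inverse z \<in> spectrum x\<close>] r d by simp
    then have "1 / norm x \<le> 1 / r" "1 / r \<le> 1 / \<delta>" using r(1) d by (simp_all add: frac_le)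
    moreover have "inverse (inverse z) = inverse (complex_of_real r)" by (simp only: r(2))
    then have "z = complex_of_real (1 / r)" by (simp add: inverse_eq_divide)
    ultimately show ?thesis by blast
  qed
  show thesis
  proof (rule that[OF y])
    show "positive_elem y"
      unfolding positive_elem_def
    proof (intro conjI subsetI sy)
      fix z assume "z \<in> spectrum y"
      then obtain r where r: "1 / norm x \<le> r" "z = complex_of_real r" using spy by blast
      have "0 \<le> 1 / norm x" by simp
      then have "0 \<le> r" using r(1) by (rule order_trans)
      then show "z \<in> complex_of_real ` {0..}" using r(2) by simp
    qed
    obtain z where z: "z \<in> spectrum y" "cmod z = norm y"
      using selfadjoint_norm_attained_spectrum[OF sy] by blast
    obtain r where r: "1 / norm x \<le> r" "r \<le> 1 / \<delta>" "z = complex_of_real r" using spy[OF z(1)] by blast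
    have "0 \<le> 1 / norm x" by simp
    then have "0 \<le> r" using r(1) by (rule order_trans)
    with r have "cmod z \<le> 1 / \<delta>" by simp
    with z(2) show "norm y \<le> 1 / \<delta>" by simp
    show "positive_elem (y - of_real (1 / norm x))"
      unfolding positive_elem_def
    proof (intro conjI subsetI)
      show "star (y - of_real (1 / norm x)) = y - of_real (1 / norm x)"
        using sy by (simp only: star_diff star_of_real)
      fix z assume "z \<in> spectrum (y - of_real (1 / norm x))"
      then have "z + of_real (1 / norm x) \<in> spectrum y"
        using spectrum_minus_of_real[of "z + of_real (1 / norm x)" "1 / norm x" y]
        by (simp only: add_diff_cancel_right')
      then obtain r where r: "r \<ge> 1 / norm x" "z + of_real (1 / norm x) = of_real r" using spy by blast
      have "z = complex_of_real (r - 1 / norm x)" using r(2) by (simp only: of_real_diff eq_diff_eq)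
      moreover have "r - 1 / norm x \<in> {0..}" using r(1) by simp
      ultimately show "z \<in> complex_of_real ` {0..}" by (rule image_eqI)
    qed
  qed
qed

text \<open>\<open>X\<close>, \<open>Y\<close>, \<open>Z\<close> stand for \<open>ip f f\<close>,
  \<open>ip g g\<close>, \<open>ip f g\<close>, and the hypothesis expands the form at
  \<open>f - act c g\<close>. The abstract shape serves the inner product and also finite frame
  sums.\<close>

lemma cstar_Cauchy_Schwarz:
  assumes pos: "\<And>c. positive_elem (X - Z * star c - c * star Z + c * Y * star c)"
    and Y: "positive_elem Y"
  shows "(norm Z)\<^sup>2 \<le> norm X * norm Y"
proof -
  have *: "(norm Z)\<^sup>2 \<le> norm X * s" if s: "s > 0" "norm Y \<le> s" for s
  proof -
    define W where "W = Z * star Z"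
    have W: "positive_elem W" "norm W = (norm Z)\<^sup>2"
      using cstar_identity[of "star Z"] by (simp_all add: W_def positive_elem_mult_star star_star)
    define V where "V = X + (1 / s\<^sup>2) *\<^sub>R (Z * Y * star Z)"
    \<comment> \<open>The choice \<open>c = Z / s\<close> puts the scalar \<open>1 / s\<close>, with
      \<open>s \<ge> norm Y\<close>, in place of an inverse of \<open>Y\<close>, which need not
      exist. Letting a positive \<open>s\<close> decrease to \<open>norm Y\<close> covers
      \<open>Y = 0\<close>.\<close>
    have "X - Z * star ((1/s) *\<^sub>R Z) - ((1/s) *\<^sub>R Z) * star Z + ((1/s) *\<^sub>R Z) * Y * star ((1/s) *\<^sub>R Z)
        = V - (2 / s) *\<^sub>R W"
      by (simp add: V_def W_def star_scaleR power2_eq_square algebra_simps flip: scaleR_add_left)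
    then have "positive_elem (V - (2 / s) *\<^sub>R W)" using pos[of "(1/s) *\<^sub>R Z"] by simp
    moreover have "positive_elem ((2 / s) *\<^sub>R W)" using W s by (intro positive_elem_scaleR) simp_all
    ultimately have "norm ((2 / s) *\<^sub>R W) \<le> norm V" by (intro norm_mono_positive)
    also have "norm V \<le> norm X + (1 / s\<^sup>2) * norm (Z * Y * star Z)"
      unfolding V_def using norm_triangle_ineq[of X "(1 / s\<^sup>2) *\<^sub>R (Z * Y * star Z)"] by simp
    also have "norm (Z * Y * star Z) \<le> norm Z * norm Y * norm Z"
      by (metis norm_mult_ineq norm_star mult_right_mono norm_ge_zero order_trans)
    also have "\<dots> \<le> norm Z * s * norm Z" using s by (intro mult_right_mono mult_left_mono) simp_all
    finally have "2 / s * (norm Z)\<^sup>2 \<le> norm X + (norm Z)\<^sup>2 / s"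
      using s W by (simp add: power2_eq_square divide_simps mult_ac)
    then show ?thesis using s by (simp add: field_simps)
  qed
  show ?thesis
  proof (rule field_le_epsilon)
    fix e :: real assume e: "e > 0"
    define s where "s = norm Y + e / (norm X + 1)"
    have "(norm Z)\<^sup>2 \<le> norm X * s"
      using e by (intro *) (simp_all add: s_def add_nonneg_pos)
    also have "\<dots> \<le> norm X * norm Y + e"
    proof -
      have "norm X + 1 > 0" by (simp add: add_nonneg_pos)
      moreover have "norm X * e \<le> e * (norm X + 1)" using e by (simp add: algebra_simps)
      ultimately have "norm X * (e / (norm X + 1)) \<le> e" by (simp add: pos_divide_le_eq)
      then show ?thesis by (simp add: s_def distrib_left)
    qed
    finally show "(norm Z)\<^sup>2 \<le> norm X * norm Y + e" .
  qed
qed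

section \<open>Central elements\<close>

lemma algebra_centerD: "c \<in> algebra_center \<Longrightarrow> c * a = a * c"
  by (simp add: algebra_center_def)

lemma algebra_centerI: "(\<And>a. c * a = a * c) \<Longrightarrow> c \<in> algebra_center"
  by (simp add: algebra_center_def)

lemma algebra_center_add:
  "c \<in> algebra_center \<Longrightarrow> d \<in> algebra_center \<Longrightarrow> c + d \<in> algebra_center"
  by (intro algebra_centerI) (simp add: algebra_centerD distrib_left distrib_right)

lemma algebra_center_diff:
  "c \<in> algebra_center \<Longrightarrow> d \<in> algebra_center \<Longrightarrow> c - d \<in> algebra_center"
  by (intro algebra_centerI) (simp add: algebra_centerD left_diff_distrib right_diff_distrib)

lemma algebra_center_scaleR: "c \<in> algebra_center \<Longrightarrow> r *\<^sub>R c \<in> algebra_center"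
  by (intro algebra_centerI) (simp add: algebra_centerD)

lemma algebra_center_of_real [simp]: "of_real r \<in> algebra_center"
  by (simp add: algebra_center_def of_real_mult_eq mult_of_real_eq)

lemma algebra_center_star:
  assumes "c \<in> algebra_center" shows "star c \<in> algebra_center"
proof (rule algebra_centerI)
  fix a
  have "star (star a * c) = star (c * star a)" using algebra_centerD[OF assms, of "star a"] by simp
  then show "star c * a = a * star c" by (simp add: star_mult star_star)
qed

lemma algebra_center_mult_left_commute:
  assumes "c \<in> algebra_center" shows "a * (c * b) = c * (a * b)"
  using algebra_centerD[OF assms, of a] by (simp flip: mult.assoc)

lemma algebra_center_mult:
  assumes c: "c \<in> algebra_center" and d: "d \<in> algebra_center"
  shows "c * d \<in> algebra_center"
proof (rule algebra_centerI)
  fix a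
  have "c * d * a = c * (a * d)" by (simp only: mult.assoc algebra_centerD[OF d, of a])
  also have "\<dots> = a * (c * d)" by (rule algebra_center_mult_left_commute[OF c, symmetric])
  finally show "c * d * a = a * (c * d)" .
qed

lemma algebra_center_inverse:
  assumes c: "c \<in> algebra_center" and d: "c * d = 1" "d * c = 1"
  shows "d \<in> algebra_center"
proof (rule algebra_centerI)
  fix a
  have "d * a = d * a * (c * d)" using d by simp
  also have "\<dots> = d * c * (a * d)"
    using algebra_center_mult_left_commute[OF c, of a d] by (simp only: mult.assoc)
  also have "\<dots> = a * d" using d by simp
  finally show "d * a = a * d" .
qed

lemma algebra_center_abs:
  assumes "star u = u" "u \<in> algebra_center"
  obtains a where "positive_elem a" "a \<in> algebra_center" "a * a = u * u" "norm a = norm u"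
proof -
  obtain a where a: "positive_elem a" "a * a = u * u" "\<And>d. d * (u * u) = (u * u) * d \<Longrightarrow> d * a = a * d"
    using positive_elem_sqrt[OF positive_elem_square[OF assms(1)]] by blast
  have "d * (u * u) = (u * u) * d" for d
    by (simp only: algebra_center_mult_left_commute[OF assms(2)] algebra_centerD[OF assms(2), of d] mult.assoc)
  then have "a \<in> algebra_center" by (intro algebra_centerI a(3)[symmetric])
  moreover have "(norm a)\<^sup>2 = (norm u)\<^sup>2"
    using norm_square_selfadjoint[OF assms(1)] norm_square_selfadjoint[OF positive_elemD(1)[OF a(1)]] a(2)
    by simp
  then have "norm a = norm u" by simp
  ultimately show thesis using a that by blast
qed

section \<open>Infinite sums\<close>

text \<open>Beyond \<open>F\<close> the partial sums grow by positive terms, and positivity survives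
  the limit. \<open>F = {}\<close> gives positivity of the sum itself; general \<open>F\<close>
  bounds partial sums by it.\<close>

lemma positive_elem_has_sum_minus:
  assumes s: "(f has_sum s) A" and pos: "\<And>x. x \<in> A \<Longrightarrow> positive_elem (f x)"
    and F: "finite F" "F \<subseteq> A"
  shows "positive_elem (s - (\<Sum>x\<in>F. f x))"
proof (rule positive_elem_tendsto)
  show "((\<lambda>X. (\<Sum>x\<in>X. f x) - (\<Sum>x\<in>F. f x)) \<longlongrightarrow> s - (\<Sum>x\<in>F. f x)) (finite_subsets_at_top A)"
    using s unfolding has_sum_def by (rule tendsto_diff[OF _ tendsto_const])
  show "\<forall>\<^sub>F X in finite_subsets_at_top A. positive_elem ((\<Sum>x\<in>X. f x) - (\<Sum>x\<in>F. f x))"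
    unfolding eventually_finite_subsets_at_top
  proof (intro exI[of _ F] conjI allI impI F)
    fix X assume X: "finite X \<and> F \<subseteq> X \<and> X \<subseteq> A"
    then have "(\<Sum>x\<in>X. f x) - (\<Sum>x\<in>F. f x) = (\<Sum>x\<in>X - F. f x)" by (simp add: sum_diff)
    also have "positive_elem \<dots>" using X pos by (intro positive_elem_sum) auto
    finally show "positive_elem ((\<Sum>x\<in>X. f x) - (\<Sum>x\<in>F. f x))" .
  qed
  show "finite_subsets_at_top A \<noteq> bot" by simp
qed

text \<open>Applied to differences \<open>F - F0\<close>, the domination makes the partial sums of
  \<open>u\<close> a Cauchy net. Absolute convergence, which a frame expansion need not have, does
  not enter.\<close>

lemma summable_on_norm_square_dominated:
  fixes u :: "'j \<Rightarrow> 'h::banach" and r :: "'j \<Rightarrow> 'a::real_normed_vector"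
  assumes r: "r summable_on J" and B: "B > 0"
    and dom: "\<And>F. finite F \<Longrightarrow> F \<subseteq> J \<Longrightarrow> (norm (\<Sum>j\<in>F. u j))\<^sup>2 \<le> B * norm (\<Sum>j\<in>F. r j)"
  shows "u summable_on J"
proof -
  obtain L where L: "((\<lambda>F. \<Sum>j\<in>F. r j) \<longlongrightarrow> L) (finite_subsets_at_top J)"
    using r unfolding summable_on_def has_sum_def by blast
  have "\<exists>P. eventually P (finite_subsets_at_top J) \<and>
      (\<forall>F G. P F \<and> P G \<longrightarrow> dist (\<Sum>j\<in>F. u j) (\<Sum>j\<in>G. u j) < e)" if e: "e > 0" for e :: real
  proof -
    \<comment> \<open>Chosen so that \<open>B * (2 * d) = (e / 2)\<^sup>2\<close>: two partial sums
      of \<open>r\<close> within \<open>d\<close> of \<open>L\<close> differ by less than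
      \<open>2 * d\<close>.\<close>
    define d where "d = (e / 2)\<^sup>2 / (2 * B)"
    have d: "d > 0" using e B by (simp add: d_def)
    have "\<forall>\<^sub>F F in finite_subsets_at_top J. dist (\<Sum>j\<in>F. r j) L < d" using L d by (rule tendstoD)
    then obtain F0 where F0': "finite F0 \<and> F0 \<subseteq> J \<and>
        (\<forall>F. finite F \<and> F0 \<subseteq> F \<and> F \<subseteq> J \<longrightarrow> dist (\<Sum>j\<in>F. r j) L < d)"
      unfolding eventually_finite_subsets_at_top by (rule exE)
    then have F0: "finite F0" "F0 \<subseteq> J" by simp_all
    have close: "dist (\<Sum>j\<in>F. r j) L < d" if "finite F" "F0 \<subseteq> F" "F \<subseteq> J" for F
      using F0' that by simp
    have near: "dist (\<Sum>j\<in>F. u j) (\<Sum>j\<in>F0. u j) < e / 2" if F: "finite F" "F0 \<subseteq> F" "F \<subseteq> J" for F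
    proof -
      have "norm (\<Sum>j\<in>F - F0. r j) = dist (\<Sum>j\<in>F. r j) (\<Sum>j\<in>F0. r j)"
        using F by (simp add: sum_diff dist_norm)
      also have "\<dots> < 2 * d"
        using close[OF F] close[OF F0(1) order_refl F0(2)]
          dist_triangle2[of "\<Sum>j\<in>F. r j" "\<Sum>j\<in>F0. r j" L] by linarith
      finally have "B * norm (\<Sum>j\<in>F - F0. r j) < B * (2 * d)" by (rule mult_strict_left_mono[OF _ B])
      also have "\<dots> = (e / 2)\<^sup>2" using B by (simp add: d_def)
      finally have small: "B * norm (\<Sum>j\<in>F - F0. r j) < (e / 2)\<^sup>2" .
      have "(norm (\<Sum>j\<in>F - F0. u j))\<^sup>2 \<le> B * norm (\<Sum>j\<in>F - F0. r j)"
        using F by (intro dom) auto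
      then have "(norm (\<Sum>j\<in>F - F0. u j))\<^sup>2 < (e / 2)\<^sup>2" using small by (rule le_less_trans)
      then have "norm (\<Sum>j\<in>F - F0. u j) < e / 2" by (rule power_less_imp_less_base) (use e in simp)
      then show ?thesis using F by (simp add: sum_diff dist_norm)
    qed
    show ?thesis
    proof (intro exI[of _ "\<lambda>F. finite F \<and> F0 \<subseteq> F \<and> F \<subseteq> J"] conjI allI impI)
      show "\<forall>\<^sub>F F in finite_subsets_at_top J. finite F \<and> F0 \<subseteq> F \<and> F \<subseteq> J"
        unfolding eventually_finite_subsets_at_top using F0 by (intro exI[of _ F0]) auto
      fix F G assume FG: "(finite F \<and> F0 \<subseteq> F \<and> F \<subseteq> J) \<and> (finite G \<and> F0 \<subseteq> G \<and> G \<subseteq> J)"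
      then have "finite F" "F0 \<subseteq> F" "F \<subseteq> J" "finite G" "F0 \<subseteq> G" "G \<subseteq> J" by blast+
      then show "dist (\<Sum>j\<in>F. u j) (\<Sum>j\<in>G. u j) < e"
        using near[of F] near[of G] dist_triangle2[of "\<Sum>j\<in>F. u j" "\<Sum>j\<in>G. u j" "\<Sum>j\<in>F0. u j"]
        by linarith
    qed
  qed
  then have "cauchy_filter (filtermap (sum u) (finite_subsets_at_top J))"
    unfolding cauchy_filter_metric_filtermap by (intro allI impI)
  moreover have "complete (UNIV :: 'h set)" by (rule complete_UNIV)
  ultimately obtain L' where "(sum u \<longlongrightarrow> L') (finite_subsets_at_top J)"
    using complete_uniform[where S = UNIV] by (force simp add: filterlim_def)
  then show ?thesis unfolding summable_on_def has_sum_def by blast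
qed

section \<open>Hilbert modules\<close>

context hilbert_module
begin

lemma act_zero_left [simp]: "act 0 f = 0"
  using act_add_left[of 0 0 f] by simp

lemma act_minus_left: "act (- a) f = - act a f"
  using act_add_left[of a "- a" f] by (intro minus_unique[symmetric]) simp

lemma act_diff_left: "act (a - b) f = act a f - act b f"
  using act_add_left[of a "- b" f] by (simp add: act_minus_left)

lemma act_scaleR_left: "act (r *\<^sub>R a) f = r *\<^sub>R act a f"
  using act_act[of "of_real r" a f] by (simp add: act_of_real of_real_mult_eq)

lemma ip_zero_left [simp]: "ip 0 g = 0" using ip_add_left[of 0 0 g] by simp

lemma ip_minus_left: "ip (- f) g = - ip f g"
  using ip_add_left[of f "- f" g] by (intro minus_unique[symmetric]) simp

lemma ip_diff_left: "ip (f - g) h = ip f h - ip g h"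
  using ip_add_left[of f "- g" h] by (simp add: ip_minus_left)

lemma ip_scaleR_left: "ip (r *\<^sub>R f) g = r *\<^sub>R ip f g"
  using ip_act_left[of "of_real r" f g] by (simp add: act_of_real of_real_mult_eq)

lemma ip_add_right: "ip f (g + h) = ip f g + ip f h"
  by (simp only: ip_star[of _ f, symmetric] ip_add_left star_add)

lemma ip_diff_right: "ip f (g - h) = ip f g - ip f h"
  by (simp only: ip_star[of _ f, symmetric] ip_diff_left star_diff)

lemma ip_scaleR_right: "ip f (r *\<^sub>R g) = r *\<^sub>R ip f g"
  by (simp only: ip_star[of _ f, symmetric] ip_scaleR_left star_scaleR)

lemma ip_act_right: "ip f (act a g) = ip f g * star a"
  by (simp only: ip_star[of _ f, symmetric] ip_act_left star_mult)

lemma ip_sum_left: "ip (\<Sum>j\<in>F. f j) g = (\<Sum>j\<in>F. ip (f j) g)"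
  by (induction F rule: infinite_finite_induct) (simp_all add: ip_add_left)

lemma norm_square: "(norm f)\<^sup>2 = norm (ip f f)"
  by (simp add: norm_eq)

lemma ip_Cauchy_Schwarz: "norm (ip f g) \<le> norm f * norm g"
proof -
  have "(norm (ip f g))\<^sup>2 \<le> norm (ip f f) * norm (ip g g)"
  proof (rule cstar_Cauchy_Schwarz[OF _ ip_positive])
    fix c
    have "ip f f - ip f g * star c - c * star (ip f g) + c * ip g g * star c
        = ip (f - act c g) (f - act c g)"
      by (simp add: ip_diff_left ip_diff_right ip_act_left ip_act_right ip_star left_diff_distrib mult.assoc)
    then show "positive_elem (ip f f - ip f g * star c - c * star (ip f g) + c * ip g g * star c)"
      by (simp add: ip_positive)
  qed
  then have "(norm (ip f g))\<^sup>2 \<le> (norm f * norm g)\<^sup>2"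
    by (simp add: norm_square[symmetric] power_mult_distrib)
  then show ?thesis by (rule power2_le_imp_le) simp
qed

lemma bounded_linear_ip_left: "bounded_linear (\<lambda>f. ip f g)"
  by (rule bounded_linear_intro[where K = "norm g"])
    (simp_all add: ip_add_left ip_scaleR_left ip_Cauchy_Schwarz)

lemma ip_cong: "(\<And>h. ip f h = ip g h) \<Longrightarrow> f = g"
  using ip_definite[of "f - g"] by (simp add: ip_diff_left)

text \<open>\<open>GL\<close> provides only complex linearity; linearity over the algebra comes from
  moving \<open>T\<close> across the inner product.\<close>

lemma self_adjoint_act:
  assumes "\<And>f g. ip (T f) g = ip f (T g)" shows "T (act a f) = act a (T f)"
  by (rule ip_cong) (simp add: assms ip_act_left)

text \<open>Polarization between \<open>f\<close> and \<open>t B f\<close>, with \<open>t = 1 / \<kappa>\<close>.\<close>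

lemma norm_le_of_form_bounds:
  assumes add: "\<And>f g. B (f + g) = B f + B g" and sa: "\<And>f g. ip (B f) g = ip f (B g)"
    and k: "\<kappa> > 0"
    and up: "\<And>f. positive_elem (\<kappa> *\<^sub>R ip f f - ip (B f) f)"
    and low: "\<And>f. positive_elem (\<kappa> *\<^sub>R ip f f + ip (B f) f)"
  shows "norm (B f) \<le> \<kappa> * norm f"
proof -
  define g where "g = (1 / \<kappa>) *\<^sub>R B f"
  have diff: "B (f - g) = B f - B g" using add[of "f - g" g] by simp
  have 1: "ip (B f) g = (1 / \<kappa>) *\<^sub>R ip (B f) (B f)" "ip (B g) f = (1 / \<kappa>) *\<^sub>R ip (B f) (B f)"
    "ip g g = (1 / \<kappa>\<^sup>2) *\<^sub>R ip (B f) (B f)"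
    by (simp_all add: sa[of g f]) (simp_all add: g_def ip_scaleR_left ip_scaleR_right power2_eq_square)
  \<comment> \<open>In \<open>ip (B (f - g)) (f - g) - ip (B (f + g)) (f + g)\<close> the diagonal
    terms cancel; the mixed ones that remain are, for this \<open>g\<close>, multiples of
    \<open>ip (B f) (B f)\<close>.\<close>
  have "(\<kappa> *\<^sub>R ip (f + g) (f + g) - ip (B (f + g)) (f + g)) + (\<kappa> *\<^sub>R ip (f - g) (f - g) + ip (B (f - g)) (f - g))
      = (2 * \<kappa>) *\<^sub>R ip f f + (2 * \<kappa>) *\<^sub>R ip g g - 2 *\<^sub>R ip (B f) g - 2 *\<^sub>R ip (B g) f"
    by (simp add: diff add ip_add_left ip_add_right ip_diff_left ip_diff_right algebra_simps scaleR_2)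
      (simp add: scaleR_2 scaleR_add_right flip: scaleR_scaleR)
  also have "\<dots> = (2 * \<kappa>) *\<^sub>R ip f f - (2 / \<kappa>) *\<^sub>R ip (B f) (B f)"
    using k by (simp add: 1 power2_eq_square algebra_simps flip: scaleR_add_left)
  finally have "positive_elem ((2 * \<kappa>) *\<^sub>R ip f f - (2 / \<kappa>) *\<^sub>R ip (B f) (B f))"
    using positive_elem_add[OF up[of "f + g"] low[of "f - g"]] by simp
  then have "positive_elem ((\<kappa> / 2) *\<^sub>R ((2 * \<kappa>) *\<^sub>R ip f f - (2 / \<kappa>) *\<^sub>R ip (B f) (B f)))"
    using k by (intro positive_elem_scaleR) simp_all
  then have "positive_elem (\<kappa>\<^sup>2 *\<^sub>R ip f f - ip (B f) (B f))"
    using k by (simp add: scaleR_diff_right power2_eq_square)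
  then have "norm (ip (B f) (B f)) \<le> norm (\<kappa>\<^sup>2 *\<^sub>R ip f f)"
    by (intro norm_mono_positive ip_positive)
  then have "(norm (B f))\<^sup>2 \<le> (\<kappa> * norm f)\<^sup>2"
    by (simp add: norm_square[symmetric] power_mult_distrib)
  then show ?thesis by (rule power2_le_imp_le) (use k in simp)
qed

text \<open>\<open>T f = h\<close> says that \<open>f\<close> is a fixed point of
  \<open>f \<mapsto> B f + h / M\<close> with \<open>B = 1 - T / M\<close>. Only additivity and
  symmetry are asked of \<open>T\<close>; the Lipschitz estimate comes from the form bounds.\<close>

lemma bij_of_form_bounds:
  assumes add: "\<And>f g. T (f + g) = T f + T g" and sa: "\<And>f g. ip (T f) g = ip f (T g)"
    and m: "0 < m" "m \<le> M"
    and low: "\<And>f. positive_elem (ip (T f) f - m *\<^sub>R ip f f)"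
    and up: "\<And>f. positive_elem (M *\<^sub>R ip f f - ip (T f) f)"
  shows "bij T"
proof -
  \<comment> \<open>The form of \<open>B\<close> lies between 0 and \<open>1 - m / M\<close>; half
    of \<open>m / M\<close> is given away so that \<open>\<kappa>\<close> is positive also for
    \<open>m = M\<close>.\<close>
  define \<kappa> where "\<kappa> = 1 - m / (2 * M)"
  have k: "0 < \<kappa>" "\<kappa> < 1" using m by (simp_all add: \<kappa>_def field_simps)
  define B where "B f = f - (1 / M) *\<^sub>R T f" for f
  have Badd: "B (f + g) = B f + B g" for f g by (simp add: B_def add scaleR_add_right)
  have Bsa: "ip (B f) g = ip f (B g)" for f g
    by (simp add: B_def ip_diff_left ip_diff_right ip_scaleR_left ip_scaleR_right sa)
  have Bnorm: "norm (B f) \<le> \<kappa> * norm f" for f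
  proof (rule norm_le_of_form_bounds[OF Badd Bsa k(1)])
    fix f
    have "\<kappa> *\<^sub>R ip f f - ip (B f) f
        = (1 / M) *\<^sub>R (ip (T f) f - m *\<^sub>R ip f f) + (m / (2 * M)) *\<^sub>R ip f f"
      using m by (simp add: B_def \<kappa>_def ip_diff_left ip_scaleR_left algebra_simps flip: scaleR_add_left)
    also have "positive_elem \<dots>"
      using m by (intro positive_elem_add positive_elem_scaleR low ip_positive) simp_all
    finally show "positive_elem (\<kappa> *\<^sub>R ip f f - ip (B f) f)" .
    have "\<kappa> *\<^sub>R ip f f + ip (B f) f = \<kappa> *\<^sub>R ip f f + (1 / M) *\<^sub>R (M *\<^sub>R ip f f - ip (T f) f)"
      using m by (simp add: B_def ip_diff_left ip_scaleR_left scaleR_diff_right)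
    also have "positive_elem \<dots>"
      using m k by (intro positive_elem_add positive_elem_scaleR up ip_positive) simp_all
    finally show "positive_elem (\<kappa> *\<^sub>R ip f f + ip (B f) f)" .
  qed
  have "\<exists>!f. T f = h" for h
  proof -
    define G where "G f = B f + (1 / M) *\<^sub>R h" for f
    have "dist (G f) (G g) \<le> \<kappa> * dist f g" for f g
    proof -
      have "B f - B g = B (f - g)" using Badd[of "f - g" g] by simp
      then show ?thesis using Bnorm[of "f - g"] by (simp add: G_def dist_norm)
    qed
    then have "\<exists>!f. G f = f" using k by (intro banach_fix_type[of \<kappa>]) auto
    moreover have "G f = f \<longleftrightarrow> T f = h" for f
    proof -
      have "G f = f \<longleftrightarrow> (1 / M) *\<^sub>R h = (1 / M) *\<^sub>R T f" by (auto simp: G_def B_def algebra_simps)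
      then show ?thesis using m by auto
    qed
    ultimately show ?thesis by simp
  qed
  then show ?thesis by (simp add: bij_iff)
qed

text \<open>\<open>a\<close> is the absolute value of \<open>u\<close> and \<open>w = a - u\<close>
  twice its negative part, so \<open>u * w = - a * w\<close>. Conjugating the bound by
  \<open>w\<close> makes \<open>- a * (w * z * w) - m * (w * ip f f * w)\<close> positive although
  both subtracted terms are positive; hence \<open>act w f = 0\<close>. In the application
  \<open>z\<close> is \<open>ip (S f) f\<close>.\<close>

lemma act_abs_of_form_bound:
  assumes u: "star u = u" "u \<in> algebra_center" and a: "positive_elem a" "a \<in> algebra_center" "a * a = u * u"
    and m: "m > 0" and z: "positive_elem z" and low: "positive_elem (u * z - m *\<^sub>R ip f f)"
  shows "act a f = act u f"
proof -
  define w where "w = a - u"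
  have wc: "w \<in> algebra_center" unfolding w_def by (intro algebra_center_diff a u)
  have ws: "star w = w" by (simp add: w_def star_diff u positive_elemD(1)[OF a(1)])
  have uw: "u * w = - (a * w)"
    using algebra_centerD[OF a(2), of u] by (simp add: w_def right_diff_distrib a(3))
  have "w * (u * z - m *\<^sub>R ip f f) * star w = w * (u * z) * w - m *\<^sub>R (w * ip f f * w)"
    by (simp add: ws left_diff_distrib right_diff_distrib)
  moreover have "w * (u * z) * w = - (a * (w * z * w))"
  proof -
    have "w * (u * z) * w = (u * w) * z * w" using algebra_centerD[OF wc, of u] by (simp flip: mult.assoc)
    then show ?thesis by (simp add: uw mult.assoc)
  qed
  ultimately have 1: "positive_elem (- (a * (w * z * w)) - m *\<^sub>R (w * ip f f * w))"
    using positive_elem_conjugate[OF low, of w] by simp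
  have wzw: "positive_elem (w * z * w)" "positive_elem (w * ip f f * w)"
    using positive_elem_conjugate[OF z, of w] positive_elem_conjugate[OF ip_positive, of w f] ws by simp_all
  have "positive_elem (a * (w * z * w))"
    by (rule positive_elem_mult[OF a(1) wzw(1) algebra_centerD[OF a(2)]])
  from positive_elem_add[OF this 1] have "positive_elem (- (m *\<^sub>R (w * ip f f * w)))" by simp
  moreover have "positive_elem (m *\<^sub>R (w * ip f f * w))" using m wzw by (intro positive_elem_scaleR) simp_all
  ultimately have "m *\<^sub>R (w * ip f f * w) = 0" by (intro positive_elem_antisym)
  then have "ip (act w f) (act w f) = 0" using m by (simp add: ip_act_left ip_act_right ws mult.assoc)
  then have "act w f = 0" by (rule ip_definite)
  then show ?thesis by (simp add: w_def act_diff_left)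
qed

text \<open>Since \<open>v\<close> is bounded below by \<open>\<kappa>\<close> on \<open>f\<close>, it may be replaced by \<open>\<epsilon> + \<bar>v - \<epsilon>\<bar>\<close>, that is, reflected at
  \<open>\<epsilon> < \<kappa>\<close>.\<close>

lemma central_coefficient_bounded_below:
  assumes v: "positive_elem v" "v \<in> algebra_center" and e: "0 < \<epsilon>" "\<epsilon> < \<kappa>"
    and low: "\<And>w. \<kappa> * norm (act w f) \<le> norm (act v (act w f))"
  obtains v' where "v' \<in> algebra_center" "positive_elem (v' - of_real \<epsilon>)" "act v' f = act v f"
    "norm v' \<le> norm v + 2 * \<epsilon>"
proof -
  define u where "u = v - of_real \<epsilon>"
  have u: "star u = u" "u \<in> algebra_center"
    unfolding u_def by (simp add: star_diff positive_elemD(1)[OF v(1)]) (intro algebra_center_diff v algebra_center_of_real)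
  obtain a where a: "positive_elem a" "a \<in> algebra_center" "a * a = u * u" "norm a = norm u"
    by (rule algebra_center_abs[OF u])
  \<comment> \<open>Twice the negative part of \<open>v - \<epsilon>\<close>: \<open>v\<close>
    stretches \<open>act w f\<close> by at most \<open>\<epsilon>\<close>, so the lower bound
    \<open>\<kappa>\<close> forces \<open>act w f = 0\<close>.\<close>
  define w where "w = a - u"
  have wc: "w \<in> algebra_center" unfolding w_def by (intro algebra_center_diff a u)
  have sv: "star v = v" by (rule positive_elemD(1)[OF v(1)])
  have ws: "star w = w" by (simp add: w_def star_diff u positive_elemD(1)[OF a(1)])
  have uw: "u * w = - (a * w)"
    using algebra_centerD[OF a(2), of u] by (simp add: w_def right_diff_distrib a(3))
  define n where "n = ip (act w f) (act w f)"
  define q where "q = ip f f * w"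
  have n: "n = w * q" by (simp add: n_def q_def ip_act_left ip_act_right ws mult.assoc)
  have nn: "positive_elem n" by (simp add: n_def ip_positive)
  have "ip (act v g) (act v g) = v * (ip g g * v)" for g
    by (simp add: ip_act_left ip_act_right sv mult.assoc)
  then have vn: "ip (act v (act w f)) (act v (act w f)) = v * (v * n)"
    using algebra_centerD[OF v(2), of n] by (simp only: n_def)
  have ev: "positive_elem (of_real \<epsilon> + v)" using e v by (intro positive_elem_add) simp_all
  have aev: "positive_elem (a * (of_real \<epsilon> + v))"
    by (rule positive_elem_mult[OF a(1) ev algebra_centerD[OF a(2)]])
  have "u * n = v * n - \<epsilon> *\<^sub>R n"
    by (simp only: u_def left_diff_distrib of_real_mult_eq)
  \<comment> \<open>The factorization of \<open>v * v - \<epsilon>\<^sup>2\<close>; below,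
    \<open>u\<close> becomes \<open>- a\<close> because \<open>n\<close> carries the factor
    \<open>w\<close>.\<close>
  then have "(of_real \<epsilon> + v) * (u * n) = v * (v * n) - \<epsilon>\<^sup>2 *\<^sub>R n"
    by (simp add: distrib_right right_diff_distrib of_real_mult_eq scaleR_diff_right scaleR_add_right
        power2_eq_square)
  then have "\<epsilon>\<^sup>2 *\<^sub>R n - v * (v * n) = - ((of_real \<epsilon> + v) * (u * n))" by simp
  also have "u * n = - (a * n)" by (simp add: n uw flip: mult.assoc)
  also have "- ((of_real \<epsilon> + v) * - (a * n)) = a * (of_real \<epsilon> + v) * n"
    using algebra_center_mult_left_commute[OF a(2), of "of_real \<epsilon> + v" n]
    by (simp only: mult.assoc mult_minus_right minus_minus)
  also have "positive_elem \<dots>"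
    by (rule positive_elem_mult[OF aev nn algebra_centerD])
      (intro algebra_center_mult algebra_center_add algebra_center_of_real a v)
  finally have "positive_elem (\<epsilon>\<^sup>2 *\<^sub>R n - ip (act v (act w f)) (act v (act w f)))" by (simp only: vn)
  then have "norm (ip (act v (act w f)) (act v (act w f))) \<le> norm (\<epsilon>\<^sup>2 *\<^sub>R n)"
    by (rule norm_mono_positive[OF ip_positive])
  also have "\<dots> = (\<epsilon> * norm (act w f))\<^sup>2"
    unfolding n_def power_mult_distrib norm_square by simp
  finally have "(norm (act v (act w f)))\<^sup>2 \<le> (\<epsilon> * norm (act w f))\<^sup>2"
    by (simp only: norm_square)
  then have "norm (act v (act w f)) \<le> \<epsilon> * norm (act w f)"
    by (rule power2_le_imp_le) (use e in simp)
  with low[of w] have "\<kappa> * norm (act w f) \<le> \<epsilon> * norm (act w f)" by (rule order_trans)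
  then have "act w f = 0" using e(2) by (simp add: mult_le_cancel_right)
  then have af: "act a f = act u f" by (simp add: w_def act_diff_left)
  show thesis
  proof (rule that[of "of_real \<epsilon> + a"])
    show "of_real \<epsilon> + a \<in> algebra_center" by (intro algebra_center_add algebra_center_of_real a)
    show "positive_elem (of_real \<epsilon> + a - of_real \<epsilon>)" using a by simp
    show "act (of_real \<epsilon> + a) f = act v f" by (simp add: act_add_left af u_def act_diff_left)
    have "norm a \<le> norm v + \<epsilon>"
      using norm_triangle_ineq4[of v "of_real \<epsilon>"] e by (simp add: a(4) u_def)
    then show "norm (of_real \<epsilon> + a) \<le> norm v + 2 * \<epsilon>"
      using norm_triangle_ineq[of "of_real \<epsilon>" a] e by simp
  qed
qed

text \<open>\<open>c\<close> itself need not be self-adjoint. With \<open>d = c - star c\<close>,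
  symmetry of \<open>C\<close> gives \<open>d * ip g g = 0\<close>, so
  \<open>ip (act d g) (act d g)\<close> vanishes.\<close>

lemma act_star_of_self_adjoint:
  assumes sa: "\<And>f g. ip (C f) g = ip f (C g)" and c: "c \<in> algebra_center" and Cg: "C g = act c g"
  shows "act (star c) g = act c g"
proof -
  define p where "p = ip g g"
  have "c * p = p * star c"
    using sa[of g g] by (simp add: p_def Cg ip_act_left ip_act_right)
  also have "\<dots> = star c * p" by (rule algebra_centerD[OF algebra_center_star[OF c], symmetric])
  finally have "(c - star c) * p = 0" by (simp add: left_diff_distrib)
  then have "ip (act (c - star c) g) (act (c - star c) g) = 0"
    by (simp add: ip_act_left ip_act_right p_def flip: mult.assoc)
  then have "act (c - star c) g = 0" by (rule ip_definite)
  then show ?thesis by (simp add: act_diff_left)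
qed

text \<open>The lower bound for the coefficient comes from one reflection; the upper bound from a second one,
  applied to the inverse coefficient and the inverse operator.\<close>

lemma central_coefficient_of_bounded_bij:
  assumes C: "\<And>f g. ip (C f) g = ip f (C g)" and D: "\<And>f g. ip (D f) g = ip f (D g)"
    and CD: "\<And>f. C (D f) = f" and DC: "\<And>f. D (C f) = f"
    and K: "0 < K" "\<And>f. norm (C f) \<le> K * norm f" and L: "0 < L" "\<And>f. norm (D f) \<le> L * norm f"
    and v: "positive_elem v" "v \<in> algebra_center" and Cg: "C g = act v g"
  obtains c where "positive_elem c" "c \<in> algebra_center" "C g = act c g"
    "positive_elem (c - of_real (1 / (2 * L + 1 / K)))" "positive_elem (of_real (2 * K) - c)"
proof -
  have Ca: "C (act a f) = act a (C f)" for a f by (rule self_adjoint_act) (rule C)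
  have Da: "D (act a f) = act a (D f)" for a f by (rule self_adjoint_act) (rule D)
  have "1 / L * norm (act w g) \<le> norm (act v (act w g))" for w
  proof -
    have "act v (act w g) = C (act w g)"
      by (simp add: Ca Cg act_act algebra_centerD[OF v(2), of w])
    moreover have "norm (act w g) \<le> L * norm (C (act w g))" using L(2)[of "C (act w g)"] by (simp add: DC)
    ultimately show ?thesis using L(1) by (simp add: field_simps)
  qed
  then obtain c1 where c1: "c1 \<in> algebra_center" "positive_elem (c1 - of_real (1 / (2 * L)))"
      "act c1 g = act v g"
    using central_coefficient_bounded_below[OF v, of "1 / (2 * L)" "1 / L" g] L(1) by (auto simp: field_simps)
  \<comment> \<open>The available upper bound on \<open>c1\<close> depends on \<open>norm v\<close>,
    hence on the frame element; the bound \<open>2 * L\<close> on its inverse does not. Therefore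
    the second reflection acts on \<open>e\<close>.\<close>
  obtain e where e: "c1 * e = 1" "e * c1 = 1" "positive_elem e" "norm e \<le> 1 / (1 / (2 * L))"
    using positive_elem_inverse[OF _ c1(2)] L(1) by auto
  have ec: "e \<in> algebra_center" using algebra_center_inverse[OF c1(1) e(1,2)] .
  have Dg: "D g = act e g"
  proof -
    have "act e g = act e (D (act c1 g))" by (simp only: c1(3) Cg[symmetric] DC)
    also have "\<dots> = D g" by (simp add: Da act_act e act_one)
    finally show ?thesis by simp
  qed
  have "1 / K * norm (act w g) \<le> norm (act e (act w g))" for w
  proof -
    have "act e (act w g) = D (act w g)"
      by (simp add: Da Dg act_act algebra_centerD[OF ec, of w])
    moreover have "norm (act w g) \<le> K * norm (D (act w g))" using K(2)[of "D (act w g)"] by (simp add: CD)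
    ultimately show ?thesis using K(1) by (simp add: field_simps)
  qed
  then obtain e' where e': "e' \<in> algebra_center" "positive_elem (e' - of_real (1 / (2 * K)))"
      "act e' g = act e g" "norm e' \<le> norm e + 2 * (1 / (2 * K))"
    using central_coefficient_bounded_below[OF e(3) ec, of "1 / (2 * K)" "1 / K" g] K(1) 
    by (auto simp: field_simps)
  obtain c where c: "e' * c = 1" "c * e' = 1" "positive_elem c" "norm c \<le> 1 / (1 / (2 * K))"
      "positive_elem (c - of_real (1 / norm e'))"
    using positive_elem_inverse[OF _ e'(2)] K(1) by auto
  show thesis
  proof (rule that[OF c(3)])
    show "c \<in> algebra_center" by (rule algebra_center_inverse[OF e'(1) c(1,2)])
    have "act c g = act c (C (D g))" by (simp only: CD)
    also have "\<dots> = C (act c (act e' g))" by (simp only: Ca Dg e'(3))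
    also have "\<dots> = C g" by (simp only: act_act c act_one)
    finally show "C g = act c g" by simp
    have "norm e' \<noteq> 0" using c(1) by auto
    \<comment> \<open>\<open>norm e \<le> 2 * L\<close>, and the reflection at
      \<open>1 / (2 * K)\<close> adds at most \<open>1 / K\<close>; the inverse \<open>c\<close> of
      \<open>e'\<close> is at least \<open>1 / norm e'\<close>, whence the constant in the
      statement.\<close>
    moreover have "norm e' \<le> 2 * L + 1 / K" using e(4) e'(4) by simp
    ultimately have "1 / (2 * L + 1 / K) \<le> 1 / norm e'" by (intro divide_left_mono mult_pos_pos) (simp_all add: add_pos_pos L(1) K(1))
    then have "positive_elem (of_real (1 / norm e' - 1 / (2 * L + 1 / K)) :: 'a)"
      by (intro positive_elem_of_real) simp
    from positive_elem_add[OF c(5) this]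
    show "positive_elem (c - of_real (1 / (2 * L + 1 / K)))" by (simp only: of_real_diff) simp
    show "positive_elem (of_real (2 * K) - c)"
      using c(4) by (intro of_real_norm_minus_positive positive_elemD(1) c(3)) simp
  qed
qed

end

section \<open>Diagonal controlled frames\<close>

locale diagonal_controlled_frame = hilbert_module act ip
  for act :: "'a::unital_cstar_algebra \<Rightarrow> 'h::banach \<Rightarrow> 'h" and ip :: "'h \<Rightarrow> 'h \<Rightarrow> 'a" +
  fixes C D :: "'h \<Rightarrow> 'h" and J :: "'j set" and \<psi> :: "'j \<Rightarrow> 'h" and \<omega> :: "'j \<Rightarrow> 'a" and m M :: real
  assumes bounded_linear_C: "bounded_linear C" and bounded_linear_D: "bounded_linear D"
    and CD: "C (D f) = f" and DC: "D (C f) = f"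
    and C_self_adjoint: "ip (C f) g = ip f (C g)"
    and coefficient_central: "j \<in> J \<Longrightarrow> \<omega> j \<in> algebra_center"
    and C_diagonal: "j \<in> J \<Longrightarrow> C (\<psi> j) = act (\<omega> j) (\<psi> j)"
    and m_pos: "0 < m"
    and controlled_summable: "(\<lambda>j. ip f (\<psi> j) * ip (C (\<psi> j)) f) summable_on J"
    and controlled_lower:
      "positive_elem ((\<Sum>\<^sub>\<infinity>j\<in>J. ip f (\<psi> j) * ip (C (\<psi> j)) f) - m *\<^sub>R ip f f)"
    and controlled_upper:
      "positive_elem (M *\<^sub>R ip f f - (\<Sum>\<^sub>\<infinity>j\<in>J. ip f (\<psi> j) * ip (C (\<psi> j)) f))"
begin

lemma D_self_adjoint: "ip (D f) g = ip f (D g)"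
  using C_self_adjoint[of "D f" "D g"] by (simp add: CD)

lemma C_act: "C (act a f) = act a (C f)"
  by (rule self_adjoint_act) (rule C_self_adjoint)

lemma star_coefficient: "j \<in> J \<Longrightarrow> act (star (\<omega> j)) (\<psi> j) = C (\<psi> j)"
  using act_star_of_self_adjoint[OF C_self_adjoint coefficient_central C_diagonal] by (simp add: C_diagonal)

text \<open>Because \<open>star (\<omega> j)\<close> acts on \<open>\<psi> j\<close> as
  \<open>\<omega> j\<close> does, \<open>C\<close> can cross from one factor of a frame term to the
  other. This yields both the polarization and the commutation of \<open>S\<close> with
  \<open>C\<close>.\<close>

lemma ip_C_mult: "j \<in> J \<Longrightarrow> ip (C f) (\<psi> j) * ip (\<psi> j) g = ip f (\<psi> j) * ip (C (\<psi> j)) g"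
proof -
  assume j: "j \<in> J"
  have "ip (C f) (\<psi> j) = ip f (\<psi> j) * star (\<omega> j)"
    using j by (simp only: C_self_adjoint C_diagonal ip_act_right)
  moreover have "ip (C (\<psi> j)) g = star (\<omega> j) * ip (\<psi> j) g"
    using j by (simp only: star_coefficient[symmetric] ip_act_left)
  ultimately show ?thesis by (simp add: mult.assoc)
qed

section \<open>The controlled form and the Bessel bound\<close>

definition Q :: "'h \<Rightarrow> 'a" where
  "Q f = (\<Sum>\<^sub>\<infinity>j\<in>J. ip f (\<psi> j) * ip (C (\<psi> j)) f)"

lemma has_sum_Q: "((\<lambda>j. ip f (\<psi> j) * ip (C (\<psi> j)) f) has_sum Q f) J"
  unfolding Q_def by (rule has_sum_infsum[OF controlled_summable])

lemma Q_lower: "positive_elem (Q f - m *\<^sub>R ip f f)"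
  unfolding Q_def by (rule controlled_lower)

text \<open>On the zero module the bounds imply neither \<open>m \<le> M\<close> nor
  \<open>M > 0\<close>, hence the maximum.\<close>

lemma Q_upper: "positive_elem (max m M *\<^sub>R ip f f - Q f)"
proof -
  have "positive_elem ((M *\<^sub>R ip f f - Q f) + (max m M - M) *\<^sub>R ip f f)"
    unfolding Q_def by (intro positive_elem_add positive_elem_scaleR ip_positive controlled_upper) simp
  then show ?thesis by (simp add: scaleR_diff_left)
qed

lemma norm_Q: "norm (Q f) \<le> max m M * (norm f)\<^sup>2"
proof -
  have "positive_elem ((Q f - m *\<^sub>R ip f f) + m *\<^sub>R ip f f)"
    using m_pos by (intro positive_elem_add positive_elem_scaleR ip_positive Q_lower) simp
  then have "norm (Q f) \<le> norm (max m M *\<^sub>R ip f f)"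
    by (intro norm_mono_positive Q_upper) simp
  then show ?thesis using m_pos by (simp add: norm_square)
qed

definition R :: "'h \<Rightarrow> 'a" where
  "R f = (1/2) *\<^sub>R (Q (f + D f) - Q f - Q (D f))"

text \<open>In the mixed terms of \<open>Q (f + D f)\<close> the operator \<open>C\<close> cancels
  \<open>D\<close>, once by self-adjointness and once by \<open>ip_C_mult\<close>, so each becomes
  the plain frame term.\<close>

lemma has_sum_R: "((\<lambda>j. ip f (\<psi> j) * ip (\<psi> j) f) has_sum R f) J"
proof -
  have "((\<lambda>j. (1/2) *\<^sub>R (ip (f + D f) (\<psi> j) * ip (C (\<psi> j)) (f + D f) - ip f (\<psi> j) * ip (C (\<psi> j)) f
      - ip (D f) (\<psi> j) * ip (C (\<psi> j)) (D f))) has_sum R f) J"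
    using has_sum_Q unfolding R_def has_sum_def sum_subtractf scaleR_sum_right[symmetric]
    by (intro tendsto_intros) auto
  moreover have "(1/2) *\<^sub>R (ip (f + D f) (\<psi> j) * ip (C (\<psi> j)) (f + D f) - ip f (\<psi> j) * ip (C (\<psi> j)) f
      - ip (D f) (\<psi> j) * ip (C (\<psi> j)) (D f)) = ip f (\<psi> j) * ip (\<psi> j) f" if j: "j \<in> J" for j
  proof -
    have 1: "ip f (\<psi> j) * ip (C (\<psi> j)) (D f) = ip f (\<psi> j) * ip (\<psi> j) f"
      by (simp add: C_self_adjoint CD)
    have 2: "ip (D f) (\<psi> j) * ip (C (\<psi> j)) f = ip f (\<psi> j) * ip (\<psi> j) f"
      using ip_C_mult[OF j, of "D f" f] by (simp add: CD)
    have "ip (f + D f) (\<psi> j) * ip (C (\<psi> j)) (f + D f) - ip f (\<psi> j) * ip (C (\<psi> j)) f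
        - ip (D f) (\<psi> j) * ip (C (\<psi> j)) (D f)
        = ip f (\<psi> j) * ip (C (\<psi> j)) (D f) + ip (D f) (\<psi> j) * ip (C (\<psi> j)) f"
      by (simp add: ip_add_left ip_add_right distrib_left distrib_right)
    also have "\<dots> = 2 *\<^sub>R (ip f (\<psi> j) * ip (\<psi> j) f)" by (simp only: 1 2 scaleR_2)
    finally show ?thesis by simp
  qed
  ultimately show ?thesis by (simp cong: has_sum_cong)
qed

lemma frame_term_positive: "positive_elem (ip f (\<psi> j) * ip (\<psi> j) f)"
  using positive_elem_mult_star[of "ip f (\<psi> j)"] by (simp add: ip_star)

lemma R_positive: "positive_elem (R f)"
  using positive_elem_has_sum_minus[OF has_sum_R frame_term_positive, of "{}" f] by simp

lemma Bessel:
  obtains B where "B > 0"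
    "\<And>f F. finite F \<Longrightarrow> F \<subseteq> J \<Longrightarrow> norm (\<Sum>j\<in>F. ip f (\<psi> j) * ip (\<psi> j) f) \<le> B * (norm f)\<^sup>2"
proof -
  obtain L where L: "L > 0" "\<And>f. norm (D f) \<le> norm f * L"
    using bounded_linear.pos_bounded[OF bounded_linear_D] by blast
  define K where "K = max m M"
  have K: "K > 0" using m_pos by (simp add: K_def)
  \<comment> \<open>The three values of \<open>Q\<close> in \<open>R f\<close> are taken at vectors
    of norm at most \<open>1 + L\<close>, 1 and \<open>L\<close> times
    \<open>norm f\<close>.\<close>
  define B where "B = K * ((1 + L)\<^sup>2 + 1 + L\<^sup>2)"
  have "(1 + L)\<^sup>2 + 1 + L\<^sup>2 > 0" using L(1) by (simp add: add_pos_nonneg)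
  then have B: "B > 0" unfolding B_def using K by simp
  show thesis
  proof (rule that[OF B])
    fix f F assume F: "finite F" "F \<subseteq> J"
    have Df: "norm (D f) \<le> L * norm f" using L(2)[of f] by (simp add: mult.commute)
    then have fDf: "norm (f + D f) \<le> (1 + L) * norm f"
      using norm_triangle_ineq[of f "D f"] by (simp add: distrib_right)
    have Qf: "norm (Q g) \<le> K * (c * norm f)\<^sup>2" if "norm g \<le> c * norm f" for g c
    proof -
      have "K * (norm g)\<^sup>2 \<le> K * (c * norm f)\<^sup>2"
        using power_mono[OF that norm_ge_zero, of 2] K by (intro mult_left_mono) simp_all
      with norm_Q[of g] show ?thesis unfolding K_def by (rule order_trans)
    qed
    have "norm (\<Sum>j\<in>F. ip f (\<psi> j) * ip (\<psi> j) f) \<le> norm (R f)"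
      by (intro norm_mono_positive positive_elem_has_sum_minus[OF has_sum_R] positive_elem_sum
          frame_term_positive F)
    also have "\<dots> \<le> norm (Q (f + D f) - Q f - Q (D f))" by (simp add: R_def)
    also have "\<dots> \<le> norm (Q (f + D f)) + norm (Q f) + norm (Q (D f))"
      using norm_triangle_ineq4[of "Q (f + D f) - Q f" "Q (D f)"] norm_triangle_ineq4[of "Q (f + D f)" "Q f"]
      by linarith
    also have "\<dots> \<le> K * ((1 + L) * norm f)\<^sup>2 + K * (1 * norm f)\<^sup>2 + K * (L * norm f)\<^sup>2"
      by (intro add_mono Qf fDf Df) simp
    also have "\<dots> = B * (norm f)\<^sup>2" by (simp only: B_def power_mult_distrib) (simp add: distrib_left distrib_right)
    finally show "norm (\<Sum>j\<in>F. ip f (\<psi> j) * ip (\<psi> j) f) \<le> B * (norm f)\<^sup>2" .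
  qed
qed

text \<open>Cauchy-Schwarz for the form with terms \<open>ip f (\<psi> j) * ip (\<psi> j) g\<close>,
  taken at \<open>f\<close> and at the sum \<open>h\<close> itself: the mixed value is
  \<open>ip h h\<close>, and the Bessel bound at \<open>h\<close> allows a factor
  \<open>(norm h)\<^sup>2\<close> to be cancelled.\<close>

lemma norm_frame_sum_le:
  assumes B: "B > 0"
    "\<And>f F. finite F \<Longrightarrow> F \<subseteq> J \<Longrightarrow> norm (\<Sum>j\<in>F. ip f (\<psi> j) * ip (\<psi> j) f) \<le> B * (norm f)\<^sup>2"
    and F: "finite F" "F \<subseteq> J"
  shows "(norm (\<Sum>j\<in>F. act (ip f (\<psi> j)) (\<psi> j)))\<^sup>2 \<le> B * norm (\<Sum>j\<in>F. ip f (\<psi> j) * ip (\<psi> j) f)"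
proof -
  define h where "h = (\<Sum>j\<in>F. act (ip f (\<psi> j)) (\<psi> j))"
  define X where "X = (\<Sum>j\<in>F. ip f (\<psi> j) * ip (\<psi> j) f)"
  define Y where "Y = (\<Sum>j\<in>F. ip h (\<psi> j) * ip (\<psi> j) h)"
  have Z: "ip h h = (\<Sum>j\<in>F. ip f (\<psi> j) * ip (\<psi> j) h)"
    by (subst h_def) (simp add: ip_sum_left ip_act_left)
  have Z': "ip h h = (\<Sum>j\<in>F. ip h (\<psi> j) * ip (\<psi> j) f)"
  proof -
    have "star (ip h h) = (\<Sum>j\<in>F. star (ip f (\<psi> j) * ip (\<psi> j) h))"
      by (subst Z) (rule linear_sum[OF bounded_linear.linear[OF bounded_linear_star]])
    then show ?thesis by (simp add: star_mult ip_star)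
  qed
  have "(norm (ip h h))\<^sup>2 \<le> norm X * norm Y"
  proof (rule cstar_Cauchy_Schwarz)
    show "positive_elem Y" unfolding Y_def by (intro positive_elem_sum frame_term_positive)
    fix c
    have "X - ip h h * star c - c * star (ip h h) + c * Y * star c
        = (\<Sum>j\<in>F. ip f (\<psi> j) * ip (\<psi> j) f - ip f (\<psi> j) * ip (\<psi> j) h * star c
            - c * (ip h (\<psi> j) * ip (\<psi> j) f) + c * (ip h (\<psi> j) * ip (\<psi> j) h) * star c)"
      unfolding sum.distrib sum_subtractf sum_distrib_left[symmetric] sum_distrib_right[symmetric]
      by (simp only: X_def[symmetric] Y_def[symmetric] Z[symmetric] Z'[symmetric] ip_star)
    also have "\<dots> = (\<Sum>j\<in>F. ip (f - act c h) (\<psi> j) * ip (\<psi> j) (f - act c h))"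
      by (intro sum.cong refl)
        (simp add: ip_diff_left ip_diff_right ip_act_left ip_act_right left_diff_distrib right_diff_distrib mult.assoc)
    also have "positive_elem \<dots>" by (intro positive_elem_sum frame_term_positive)
    finally show "positive_elem (X - ip h h * star c - c * star (ip h h) + c * Y * star c)" .
  qed
  also have "\<dots> \<le> norm X * (B * (norm h)\<^sup>2)"
    unfolding Y_def by (intro mult_left_mono B F) simp
  finally have "((norm h)\<^sup>2)\<^sup>2 \<le> (B * norm X) * (norm h)\<^sup>2" by (simp add: norm_square mult_ac)
  then have "(norm h)\<^sup>2 \<le> B * norm X"
    using B(1) by (cases "h = 0") (simp_all add: power2_eq_square)
  then show ?thesis by (simp add: h_def X_def)
qed

section \<open>The frame operator and the multiplier expansion\<close>

definition S :: "'h \<Rightarrow> 'h" where "S = frame_operator act ip J \<psi>"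

lemma has_sum_S: "((\<lambda>j. act (ip f (\<psi> j)) (\<psi> j)) has_sum S f) J"
proof -
  obtain B where B: "B > 0"
    "\<And>f F. finite F \<Longrightarrow> F \<subseteq> J \<Longrightarrow> norm (\<Sum>j\<in>F. ip f (\<psi> j) * ip (\<psi> j) f) \<le> B * (norm f)\<^sup>2"
    using Bessel by blast
  have "(\<lambda>j. act (ip f (\<psi> j)) (\<psi> j)) summable_on J"
    by (rule summable_on_norm_square_dominated[OF has_sum_imp_summable[OF has_sum_R[of f]] B(1)])
      (rule norm_frame_sum_le[OF B])
  then show ?thesis unfolding S_def frame_operator_def by (rule has_sum_infsum)
qed

lemma has_sum_ip_S: "((\<lambda>j. ip f (\<psi> j) * ip (\<psi> j) g) has_sum ip (S f) g) J"
  using has_sum_bounded_linear[OF bounded_linear_ip_left has_sum_S, of f g] by (simp add: ip_act_left)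

lemma ip_S_eq: "ip (S f) f = R f"
  by (rule has_sum_unique[OF has_sum_ip_S has_sum_R])

lemma S_self_adjoint: "ip (S f) g = ip f (S g)"
proof -
  have "((\<lambda>j. star (ip g (\<psi> j) * ip (\<psi> j) f)) has_sum star (ip (S g) f)) J"
    by (rule has_sum_bounded_linear[OF bounded_linear_star has_sum_ip_S])
  then have "((\<lambda>j. ip f (\<psi> j) * ip (\<psi> j) g) has_sum ip f (S g)) J"
    by (simp add: star_mult ip_star)
  then show ?thesis by (rule has_sum_unique[OF has_sum_ip_S])
qed

lemma S_add: "S (f + g) = S f + S g"
  by (rule ip_cong) (simp add: S_self_adjoint ip_add_left)

lemma has_sum_ip_CS: "((\<lambda>j. ip f (\<psi> j) * ip (C (\<psi> j)) g) has_sum ip (C (S f)) g) J"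
  using has_sum_ip_S[of f "C g"] by (simp add: C_self_adjoint)

lemma S_C: "S (C f) = C (S f)"
proof (rule ip_cong)
  fix g
  have "((\<lambda>j. ip f (\<psi> j) * ip (C (\<psi> j)) g) has_sum ip (S (C f)) g) J"
    using has_sum_ip_S[of "C f" g] by (simp add: ip_C_mult cong: has_sum_cong)
  then show "ip (S (C f)) g = ip (C (S f)) g" using has_sum_ip_CS by (rule has_sum_unique)
qed

lemma bij_S: "bij S"
proof -
  have Q: "ip (C (S f)) f = Q f" for f by (rule has_sum_unique[OF has_sum_ip_CS has_sum_Q])
  have "bij (\<lambda>f. C (S f))"
  proof (rule bij_of_form_bounds[where m = m and M = "max m M"])
    show "C (S (f + g)) = C (S f) + C (S g)" for f g
      by (simp add: S_add linear_add[OF bounded_linear.linear[OF bounded_linear_C]])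
    show "ip (C (S f)) g = ip f (C (S g))" for f g
      by (simp add: C_self_adjoint S_self_adjoint S_C)
    show "0 < m" by (rule m_pos)
    show "m \<le> max m M" by simp
  qed (simp_all add: Q Q_lower Q_upper)
  moreover have "bij D" by (rule o_bij[of C]) (auto simp: CD DC)
  ultimately have "bij (D \<circ> (\<lambda>f. C (S f)))" by (rule bij_comp)
  then show ?thesis by (simp add: comp_def DC)
qed

text \<open>The frame operator expands \<open>f\<close> as \<open>S g\<close> with
  \<open>g = inv S f\<close>, and \<open>C\<close> is applied termwise; by symmetry of
  \<open>S\<close>, \<open>ip g (\<psi> j)\<close> is the product of \<open>f\<close> with the dual
  element.\<close>

lemma has_sum_multiplier:
  "((\<lambda>j. act (\<omega> j * ip f (canonical_dual act ip J \<psi> j)) (\<psi> j)) has_sum C f) J"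
proof -
  define g where "g = inv S f"
  have Sinv: "S (inv S h) = h" for h by (rule surj_f_inv_f[OF bij_is_surj[OF bij_S]])
  have Sg: "S g = f" by (simp add: g_def Sinv)
  have "((\<lambda>j. C (act (ip g (\<psi> j)) (\<psi> j))) has_sum C f) J"
    using has_sum_bounded_linear[OF bounded_linear_C has_sum_S[of g]] by (simp only: Sg)
  moreover have "C (act (ip g (\<psi> j)) (\<psi> j)) = act (\<omega> j * ip f (canonical_dual act ip J \<psi> j)) (\<psi> j)"
    if j: "j \<in> J" for j
  proof -
    have "ip f (canonical_dual act ip J \<psi> j) = ip (S g) (inv S (\<psi> j))"
      by (simp add: canonical_dual_def Sg flip: S_def)
    also have "\<dots> = ip g (\<psi> j)" by (simp add: S_self_adjoint Sinv)
    finally show ?thesis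
      using algebra_centerD[OF coefficient_central[OF j], of "ip g (\<psi> j)"] j
      by (simp add: C_act C_diagonal act_act)
  qed
  ultimately show ?thesis by (simp cong: has_sum_cong)
qed

section \<open>Uniform bounds for the coefficients\<close>

lemma coefficient_bounds:
  obtains a b where "0 < a" "a \<le> b"
    "\<And>j. j \<in> J \<Longrightarrow> \<exists>c. positive_elem c \<and> c \<in> algebra_center \<and> C (\<psi> j) = act c (\<psi> j) \<and>
      positive_elem (c - of_real a) \<and> positive_elem (of_real b - c)"
proof -
  obtain K where K: "K > 0" "\<And>f. norm (C f) \<le> K * norm f"
    using bounded_linear.pos_bounded[OF bounded_linear_C] by (auto simp: mult.commute)
  obtain L where L: "L > 0" "\<And>f. norm (D f) \<le> L * norm f"
    using bounded_linear.pos_bounded[OF bounded_linear_D] by (auto simp: mult.commute)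
  define a where "a = 1 / (2 * L + 1 / K)"
  have a: "a > 0" using K L by (simp add: a_def add_pos_pos)
  show thesis
  proof (rule that[OF a])
    show "a \<le> max a (2 * K)" by simp
    fix j assume j: "j \<in> J"
    \<comment> \<open>Three replacements with the same action on \<open>\<psi> j\<close>: the real
      part \<open>u\<close> of \<open>\<omega> j\<close>, its absolute value \<open>v\<close>, and
      finally \<open>c\<close>, whose bounds do not depend on \<open>j\<close>.\<close>
    define u where "u = (1/2) *\<^sub>R (\<omega> j + star (\<omega> j))"
    have u: "star u = u" "u \<in> algebra_center"
      using coefficient_central[OF j]
      by (simp_all add: u_def star_scaleR star_add star_star add.commute
          algebra_center_scaleR algebra_center_add algebra_center_star)
    have Cu: "C (\<psi> j) = act u (\<psi> j)"
      using j by (simp add: u_def act_scaleR_left act_add_left star_coefficient C_diagonal[symmetric]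
          scaleR_half_double)
    obtain v where v: "positive_elem v" "v \<in> algebra_center" "v * v = u * u"
      by (rule algebra_center_abs[OF u])
    have "ip (C (S (\<psi> j))) (\<psi> j) = u * R (\<psi> j)"
      using algebra_centerD[OF u(2), of "R (\<psi> j)"]
      by (simp add: C_self_adjoint Cu ip_act_right u(1) ip_S_eq)
    moreover have "ip (C (S (\<psi> j))) (\<psi> j) = Q (\<psi> j)"
      by (rule has_sum_unique[OF has_sum_ip_CS has_sum_Q])
    ultimately have "positive_elem (u * R (\<psi> j) - m *\<^sub>R ip (\<psi> j) (\<psi> j))"
      using Q_lower[of "\<psi> j"] by simp
    then have "act v (\<psi> j) = act u (\<psi> j)"
      by (rule act_abs_of_form_bound[OF u v m_pos R_positive])
    then have "C (\<psi> j) = act v (\<psi> j)" using Cu by simp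
    from central_coefficient_of_bounded_bij[OF C_self_adjoint D_self_adjoint CD DC K L v(1,2) this]
    obtain c where c: "positive_elem c" "c \<in> algebra_center" "C (\<psi> j) = act c (\<psi> j)"
        "positive_elem (c - of_real a)" "positive_elem (of_real (2 * K) - c)"
      unfolding a_def by blast
    have "positive_elem ((of_real (2 * K) - c) + of_real (max a (2 * K) - 2 * K))"
      by (intro positive_elem_add c positive_elem_of_real) simp
    then have "positive_elem (of_real (max a (2 * K)) - c)" by (simp only: of_real_diff) simp
    with c show "\<exists>c. positive_elem c \<and> c \<in> algebra_center \<and> C (\<psi> j) = act c (\<psi> j) \<and>
        positive_elem (c - of_real a) \<and> positive_elem (of_real (max a (2 * K)) - c)" by blast
  qed
qed

lemma semi_normalized_positive_coefficients:
  "\<exists>\<omega>'. diagonal_on act J \<psi> C \<omega>' \<and> semi_normalized J \<omega>' \<and> positive_seq J \<omega>' \<and>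
     (\<forall>j\<in>J. centrally_faithful act (\<psi> j) \<longrightarrow> \<omega>' j = \<omega> j)"
proof -
  obtain a b where ab: "0 < a" "a \<le> b"
    and ex: "\<And>j. j \<in> J \<Longrightarrow> \<exists>c. positive_elem c \<and> c \<in> algebra_center \<and> C (\<psi> j) = act c (\<psi> j) \<and>
      positive_elem (c - of_real a) \<and> positive_elem (of_real b - c)"
    using coefficient_bounds by blast
  obtain \<omega>' where w: "\<And>j. j \<in> J \<Longrightarrow> positive_elem (\<omega>' j) \<and> \<omega>' j \<in> algebra_center \<and>
      C (\<psi> j) = act (\<omega>' j) (\<psi> j) \<and> positive_elem (\<omega>' j - of_real a) \<and> positive_elem (of_real b - \<omega>' j)"
    using bchoice[of J "\<lambda>j c. positive_elem c \<and> c \<in> algebra_center \<and> C (\<psi> j) = act c (\<psi> j) \<and>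
      positive_elem (c - of_real a) \<and> positive_elem (of_real b - c)"] ex by auto
  have "\<omega>' j = \<omega> j" if j: "j \<in> J" and f: "centrally_faithful act (\<psi> j)" for j
  proof -
    have "act (\<omega>' j - \<omega> j) (\<psi> j) = 0" using w[OF j] C_diagonal[OF j] by (simp add: act_diff_left)
    moreover have "\<omega>' j - \<omega> j \<in> algebra_center"
      using w[OF j] coefficient_central[OF j] by (intro algebra_center_diff) simp_all
    ultimately show ?thesis using f unfolding centrally_faithful_def by fastforce
  qed
  moreover have "diagonal_on act J \<psi> C \<omega>'" "positive_seq J \<omega>'"
    using w unfolding diagonal_on_def positive_seq_def by blast+
  moreover have "semi_normalized J \<omega>'"
  proof -
    have "\<omega>' j \<in> algebra_center" "of_real a \<preceq> cstar_abs (\<omega>' j)" "cstar_abs (\<omega>' j) \<preceq> of_real b"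
      if "j \<in> J" for j
      using w[OF that] by (simp_all add: cstar_le_def cstar_abs_positive_central)
    then show ?thesis unfolding semi_normalized_def using ab by blast
  qed
  ultimately show ?thesis by blast
qed

end

theorem proposition4p4:
  fixes act :: "'a::unital_cstar_algebra \<Rightarrow> 'h::banach \<Rightarrow> 'h"
    and ip :: "'h \<Rightarrow> 'h \<Rightarrow> 'a"
    and J :: "'j set"
    and \<psi> :: "'j \<Rightarrow> 'h"
    and C :: "'h \<Rightarrow> 'h"
    and \<omega> :: "'j \<Rightarrow> 'a"
  assumes "hilbert_module act ip"
    and "finitely_generated act \<or> countably_generated act"
    and "countable J"
    and "C \<in> GL act"
    and "self_adjoint ip C"
    and "diagonal_on act J \<psi> C \<omega>"
    and "controlled_frame ip C J \<psi>"
  shows "((\<forall>j\<in>J. centrally_faithful act (\<psi> j)) \<longrightarrow> semi_normalized J \<omega> \<and> positive_seq J \<omega>) \<and>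
         (\<exists>\<omega>'. diagonal_on act J \<psi> C \<omega>' \<and> semi_normalized J \<omega>' \<and> positive_seq J \<omega>' \<and>
               (\<forall>j\<in>J. centrally_faithful act (\<psi> j) \<longrightarrow> \<omega>' j = \<omega> j)) \<and>
         C = multiplier act ip J \<omega> (canonical_dual act ip J \<psi>) \<psi> \<and>
         (\<forall>f. ((\<lambda>j. act (\<omega> j * ip f (canonical_dual act ip J \<psi> j)) (\<psi> j)) has_sum C f) J)"
proof -
  obtain D where C: "bounded_linear C" and D: "bounded_linear D" "C \<circ> D = id" "D \<circ> C = id"
    using assms(4) unfolding GL_def by blast
  obtain m M where m: "0 < m" and mM: "\<And>f. (\<lambda>j. ip f (\<psi> j) * ip (C (\<psi> j)) f) summable_on J \<and>
        of_real m * ip f f \<preceq> (\<Sum>\<^sub>\<infinity>j\<in>J. ip f (\<psi> j) * ip (C (\<psi> j)) f) \<and>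
        (\<Sum>\<^sub>\<infinity>j\<in>J. ip f (\<psi> j) * ip (C (\<psi> j)) f) \<preceq> of_real M * ip f f"
    using assms(7) unfolding controlled_frame_def by blast
  interpret hilbert_module act ip by (rule assms(1))
  interpret diagonal_controlled_frame act ip C D J \<psi> \<omega> m M
  proof (intro diagonal_controlled_frame.intro diagonal_controlled_frame_axioms.intro assms(1))
    show "C (D f) = f" "D (C f) = f" for f
      using fun_cong[OF D(2), of f] fun_cong[OF D(3), of f] by simp_all
    show "ip (C f) g = ip f (C g)" for f g using assms(5) by (simp add: self_adjoint_def)
    show "\<omega> j \<in> algebra_center" "C (\<psi> j) = act (\<omega> j) (\<psi> j)" if "j \<in> J" for j
      using assms(6) that by (simp_all add: diagonal_on_def)
    show "(\<lambda>j. ip f (\<psi> j) * ip (C (\<psi> j)) f) summable_on J"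
      "positive_elem ((\<Sum>\<^sub>\<infinity>j\<in>J. ip f (\<psi> j) * ip (C (\<psi> j)) f) - m *\<^sub>R ip f f)"
      "positive_elem (M *\<^sub>R ip f f - (\<Sum>\<^sub>\<infinity>j\<in>J. ip f (\<psi> j) * ip (C (\<psi> j)) f))" for f
      using mM[of f] by (simp_all add: cstar_le_def of_real_mult_eq)
  qed (use C D m in simp_all)
  obtain \<omega>' where w: "diagonal_on act J \<psi> C \<omega>'" "semi_normalized J \<omega>'" "positive_seq J \<omega>'"
      "\<forall>j\<in>J. centrally_faithful act (\<psi> j) \<longrightarrow> \<omega>' j = \<omega> j"
    using semi_normalized_positive_coefficients by blast
  have "semi_normalized J \<omega> \<and> positive_seq J \<omega>" if "\<forall>j\<in>J. centrally_faithful act (\<psi> j)"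
  proof -
    have "\<forall>j\<in>J. \<omega>' j = \<omega> j" using w(4) that by blast
    then have "semi_normalized J \<omega>' = semi_normalized J \<omega>" "positive_seq J \<omega>' = positive_seq J \<omega>"
      by (simp_all add: semi_normalized_def positive_seq_def)
    then show ?thesis using w by simp
  qed
  moreover have "C = multiplier act ip J \<omega> (canonical_dual act ip J \<psi>) \<psi>"
    unfolding multiplier_def using has_sum_multiplier by (intro ext infsumI[symmetric])
  ultimately show ?thesis using w has_sum_multiplier by blast
qed

end
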